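(* Let $X, X_1, X_2,\ldots$ be i.i.d. real random variables with distribution $F$ and mean $\mu$, let $\psi(\theta)=\log E[e^{\theta X}]$ and $\mathcal D=\{\theta:\psi(\theta)<\infty\}$. Let $b>\mu$ and $\gamma=bn$. Suppose either $F$ is lattice with span $h$ and $0<P(X=b)<1$, or $F$ is non-lattice. Suppose $0\in\mathcal D^\circ$ and there is a unique $\theta^*\in\mathcal D^\circ$ with $\psi'(\theta^* )=b$. Let $u=u(n)$ be such that there exists $\theta'>0$ with $\theta^*+\theta'\in\mathcal D^\circ$ and $\lim_{n\to\infty}ne^{-\theta' u}=0$. Then in the non-lattice case $$\lim_{n\to\infty}\theta^*\sqrt{2\pi n\psi''(\theta^* )}e^{\theta^* nb-n\psi(\theta^* )}\tilde p(F)=\lim_{n\to\infty}\theta^*\sqrt{2\pi n\psi''(\theta^* )}e^{\theta^* nb-n\psi(\theta^* )}\tilde p(\tilde F_u)=1,$$ and in the lattice case $$\lim_{n\to\infty}\theta^*\sqrt{2\pi n\psi''(\theta^* )}e^{\theta^* nb-n\psi(\theta^* )}\tilde p(F)=\lim_{n\to\infty}\theta^*\sqrt{2\pi n\psi''(\theta^* )}e^{\theta^* nb-n\psi(\theta^* )}\tilde p(\tilde F_u)=\frac{\theta^* h}{1-e^{-\theta^* h}}.$$ Moreover, in both cases $\tilde p(\tilde F_u)-\tilde p(F)=o(\tilde p(F))$ as $n\to\infty$.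
   Context: $S_n=X_1+\cdots+X_n$. For a distribution $G$, $\tilde p(G)=P_G(S_n\ge\gamma)$ is the probability that $S_n\ge\gamma$ when $X_1,\ldots,X_n$ are i.i.d. with law $G$. The truncated distribution $\tilde F_u$ is $\tilde F_u(x)=F(x)/F(u)$ for $x\le u$ and $1$ for $x>u$. $\mathcal D^\circ$ is the interior of $\mathcal D$. $F$ is lattice if $(X-x_0)/h$ is a.s. an integer for some $x_0$ and $h>0$; the span is the largest such $h$. *)

theory Defs
  imports "HOL-Probability.Probability" "HOL-Library.Landau_Symbols"
begin

definition tail_prob :: "real measure \<Rightarrow> nat \<Rightarrow> real \<Rightarrow> real" where
  "tail_prob G n \<gamma> =
     measure (PiM {..<n} (\<lambda>_. G))
       {x \<in> space (PiM {..<n} (\<lambda>_. G)). \<gamma> \<le> (\<Sum>i<n. x i)}"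

definition trunc_dist :: "real measure \<Rightarrow> real \<Rightarrow> real measure" where
  "trunc_dist F u = density F (\<lambda>x. ennreal (indicator {..u} x / measure F {..u}))"

definition cgf :: "real measure \<Rightarrow> real \<Rightarrow> real" where
  "cgf F \<theta> = ln (\<integral>x. exp (\<theta> * x) \<partial>F)"

definition cgf_dom :: "real measure \<Rightarrow> real set" where
  "cgf_dom F = {\<theta>. integrable F (\<lambda>x. exp (\<theta> * x))}"

definition lattice_step :: "real measure \<Rightarrow> real \<Rightarrow> bool" where
  "lattice_step F h \<longleftrightarrow> h > 0 \<and> (\<exists>x0. AE x in F. (x - x0) / h \<in> \<int>)"

definition lattice_dist :: "real measure \<Rightarrow> bool" where
  "lattice_dist F \<longleftrightarrow> (\<exists>h. lattice_step F h)"

definition lattice_span :: "real measure \<Rightarrow> real \<Rightarrow> bool" where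
  "lattice_span F h \<longleftrightarrow> lattice_step F h \<and> (\<forall>h'. lattice_step F h' \<longrightarrow> h' \<le> h)"

end

theory Submission
  imports Defs
begin

text \<open>
  Tilting \<open>F\<close> by \<open>exp (\<theta>s x - \<psi>(\<theta>s))\<close> moves the mean to \<open>b\<close>, and turns the normalised tail probability into
  \<open>\<theta>s \<sigma> sqrt (2 \<pi> n) E[exp (- \<theta>s T); T \<ge> 0]\<close> for the centered sum \<open>T\<close> of \<open>n\<close> tilted variables. At scale
  \<open>1 / sqrt n\<close> the law of \<open>T\<close> looks locally like Lebesgue measure (or counting measure on the lattice):
  weighting it by a Fejer kernel, whose Fourier transform has compact support, reduces this to the Laplace
  asymptotics of powers of the characteristic function, and Levy's continuity theorem does the rest.
  The same kernel bounds \<open>P(T \<in> [y, y + l])\<close> by \<open>C / sqrt n\<close> uniformly in \<open>y\<close>. Hence, conditionally on one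
  coordinate exceeding \<open>u\<close>, the tail still costs only a factor \<open>1 / sqrt n\<close>, so truncation changes the
  normalised tail by \<open>O(n exp (- \<theta>' u))\<close>.
\<close>

section \<open>Powers of characteristic functions near the origin\<close>

text \<open>Against a compactly supported function only a compact range of frequencies counts; away
  from 0, continuity gives a uniform bound below 1 there, and the powers decay geometrically. The
  price is a kernel that must be divided out again although it has zeros. A window
  \<open>[0, K)\<close> is therefore treated first, with a kernel wide enough to be bounded below on
  it, and the windows are exhausted afterwards by a tail bound uniform in n. On a lattice the
  frequencies fill a single period and point masses can be inverted exactly. There
  \<open>P(X = b) > 0\<close> places b itself on the lattice, so the centered sums live on the
  multiples of h; the geometric sum over these points yields
  \<open>h / (1 - exp (- \<theta>s h))\<close> where Lebesgue measure yields
  \<open>1 / \<theta>s\<close>. The concentration bound uses only frequencies near 0, hence it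
  serves both cases at once.\<close>

lemma has_bochner_integral_gaussian:
  fixes s :: real
  assumes s: "s > 0"
  shows "has_bochner_integral lborel (\<lambda>x. exp (- (s\<^sup>2 * x\<^sup>2 / 2))) (sqrt (2 * pi) / s)"
proof -
  have "has_bochner_integral lborel (normal_density 0 (1 / s)) 1"
    using s by (simp add: has_bochner_integral_iff)
  then have "has_bochner_integral lborel (\<lambda>x. sqrt (2 * pi) / s * normal_density 0 (1 / s) x) (sqrt (2 * pi) / s * 1)"
    by (intro has_bochner_integral_mult_right)
  moreover have "sqrt (2 * pi) / s * normal_density 0 (1 / s) x = exp (- (s\<^sup>2 * x\<^sup>2 / 2))" for x
    using s by (simp add: normal_density_def real_sqrt_mult real_sqrt_divide power_divide field_simps)
  ultimately show ?thesis by simp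
qed

locale centered_distribution = real_distribution M for M +
  fixes \<sigma> :: real
  assumes \<sigma>_pos: "\<sigma> > 0"
    and square_integrable: "integrable M (\<lambda>x. x\<^sup>2)"
    and mean_zero: "(\<integral>x. x \<partial>M) = 0"
    and second_moment: "(\<integral>x. x\<^sup>2 \<partial>M) = \<sigma>\<^sup>2"
begin

lemma first_integrable: "integrable M (\<lambda>x. x)"
  by (rule square_integrable_imp_integrable[OF _ square_integrable]) simp

text \<open>Only a second moment is assumed, so the Taylor remainder is o(t^2) without a rate:
  \<open>min (6 x^2) (|t| |x|^3)\<close> tends to 0 pointwise and is dominated by
  \<open>6 x^2\<close>.\<close>

lemma char_approx_quadratic:
  "\<exists>e. (e \<longlongrightarrow> 0) (at 0) \<and> (\<forall>t. cmod (char M t - (1 - t\<^sup>2 * \<sigma>\<^sup>2 / 2)) \<le> t\<^sup>2 * e t)"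
proof -
  define e where "e t = expectation (\<lambda>x. min (6 * x\<^sup>2) (\<bar>t\<bar> * \<bar>x\<bar> ^ 3)) / 6" for t
  have "variance (\<lambda>x. x) = \<sigma>\<^sup>2"
    using mean_zero second_moment by simp
  then have "cmod (char M t - (1 - t\<^sup>2 * \<sigma>\<^sup>2 / 2)) \<le> t\<^sup>2 * e t" for t
    using char_approx3[OF first_integrable mean_zero square_integrable, of "\<sigma>\<^sup>2" t]
    by (simp add: e_def)
  moreover have "(e \<longlongrightarrow> 0) (at 0)"
  proof -
    have "((\<lambda>t. expectation (\<lambda>x. min (6 * x\<^sup>2) (\<bar>t\<bar> * \<bar>x\<bar> ^ 3))) \<longlongrightarrow> expectation (\<lambda>x. 0)) (at 0)"
      unfolding tendsto_at_iff_sequentially comp_def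
    proof (intro allI impI)
      fix X :: "nat \<Rightarrow> real" assume X: "X \<longlonglongrightarrow> 0"
      show "(\<lambda>i. expectation (\<lambda>x. min (6 * x\<^sup>2) (\<bar>X i\<bar> * \<bar>x\<bar> ^ 3))) \<longlonglongrightarrow> expectation (\<lambda>x. 0)"
      proof (rule integral_dominated_convergence[where w = "\<lambda>x. 6 * x\<^sup>2"])
        show "AE x in M. (\<lambda>i. min (6 * x\<^sup>2) (\<bar>X i\<bar> * \<bar>x\<bar> ^ 3)) \<longlonglongrightarrow> 0"
        proof (intro AE_I2)
          fix x :: real
          have "(\<lambda>i. min (6 * x\<^sup>2) (\<bar>X i\<bar> * \<bar>x\<bar> ^ 3)) \<longlonglongrightarrow> min (6 * x\<^sup>2) (\<bar>0\<bar> * \<bar>x\<bar> ^ 3)"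
            by (intro tendsto_intros X)
          then show "(\<lambda>i. min (6 * x\<^sup>2) (\<bar>X i\<bar> * \<bar>x\<bar> ^ 3)) \<longlonglongrightarrow> 0"
            by (simp add: min_absorb2)
        qed
      qed (use square_integrable in auto)
    qed
    then show ?thesis
      unfolding e_def by (auto intro: tendsto_divide_zero)
  qed
  ultimately show ?thesis by blast
qed

text \<open>Half of the quadratic term \<open>\<sigma>^2 t^2 / 2\<close> is given up to absorb the
  remainder; the other half survives as the exponent.\<close>

lemma char_gaussian_bound:
  "\<exists>\<delta>>0. \<forall>t. \<bar>t\<bar> \<le> \<delta> \<longrightarrow> cmod (char M t) \<le> exp (- (\<sigma>\<^sup>2 * t\<^sup>2 / 4))"
proof -
  obtain e where e: "(e \<longlongrightarrow> 0) (at 0)" "\<And>t. cmod (char M t - (1 - t\<^sup>2 * \<sigma>\<^sup>2 / 2)) \<le> t\<^sup>2 * e t"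
    using char_approx_quadratic by blast
  have "eventually (\<lambda>t. e t < \<sigma>\<^sup>2 / 4) (at 0)"
    using e(1) \<sigma>_pos by (intro order_tendstoD) auto
  then obtain d where d: "d > 0" "\<And>t. t \<noteq> 0 \<Longrightarrow> \<bar>t\<bar> < d \<Longrightarrow> e t < \<sigma>\<^sup>2 / 4"
    by (auto simp: eventually_at)
  \<comment> \<open>\<open>d / 2\<close> keeps the remainder below \<open>\<sigma>^2 / 4\<close>;
    \<open>1 / \<sigma>\<close> makes \<open>1 - t^2 \<sigma>^2 / 2\<close> nonnegative, so that it
    is its own modulus.\<close>
  define \<delta> where "\<delta> = min (d / 2) (1 / \<sigma>)"
  have "\<delta> > 0" using d \<sigma>_pos by (simp add: \<delta>_def)
  moreover have "cmod (char M t) \<le> exp (- (\<sigma>\<^sup>2 * t\<^sup>2 / 4))" if t: "\<bar>t\<bar> \<le> \<delta>" for t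
  proof (cases "t = 0")
    case True
    then show ?thesis using cmod_char_le_1[of t] by simp
  next
    case False
    have "\<bar>t\<bar> < d" using t d by (auto simp: \<delta>_def)
    have "\<bar>t\<bar> * \<sigma> \<le> 1" using t \<sigma>_pos by (auto simp: \<delta>_def field_simps)
    then have "(\<bar>t\<bar> * \<sigma>)\<^sup>2 \<le> 1" using \<sigma>_pos by (intro power_le_one) auto
    then have s: "t\<^sup>2 * \<sigma>\<^sup>2 \<le> 1" by (simp add: power_mult_distrib)
    have "cmod (char M t) \<le> cmod (complex_of_real (1 - t\<^sup>2 * \<sigma>\<^sup>2 / 2)) + cmod (char M t - complex_of_real (1 - t\<^sup>2 * \<sigma>\<^sup>2 / 2))"
      using norm_triangle_sub by blast
    also have "\<dots> \<le> (1 - t\<^sup>2 * \<sigma>\<^sup>2 / 2) + t\<^sup>2 * e t"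
      using e(2)[of t] s by (simp only: norm_of_real)
    also have "\<dots> \<le> (1 - t\<^sup>2 * \<sigma>\<^sup>2 / 2) + t\<^sup>2 * (\<sigma>\<^sup>2 / 4)"
      using d(2)[OF False \<open>\<bar>t\<bar> < d\<close>] by (intro add_left_mono mult_left_mono) auto
    also have "\<dots> = 1 + - (\<sigma>\<^sup>2 * t\<^sup>2 / 4)" by (simp add: field_simps)
    also have "\<dots> \<le> exp (- (\<sigma>\<^sup>2 * t\<^sup>2 / 4))" by (rule exp_ge_add_one_self)
    finally show ?thesis .
  qed
  ultimately show ?thesis by blast
qed

text \<open>The central limit theorem on the side of characteristic functions: in the unit disc, nth
  powers differ by at most n times the difference of the bases, which here is o(1/n).\<close>

lemma char_power_tendsto:
  "(\<lambda>n. char M (s / sqrt (real n)) ^ n) \<longlonglongrightarrow> exp (- (\<sigma>\<^sup>2 * s\<^sup>2 / 2))"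
proof -
  obtain e where e: "(e \<longlongrightarrow> 0) (at 0)" "\<And>t. cmod (char M t - (1 - t\<^sup>2 * \<sigma>\<^sup>2 / 2)) \<le> t\<^sup>2 * e t"
    using char_approx_quadratic by blast
  let ?z = "\<lambda>n. complex_of_real (1 + (- (\<sigma>\<^sup>2 * s\<^sup>2 / 2)) / real n)"
  show ?thesis
  proof (cases "s = 0")
    case True
    then show ?thesis by (simp add: char_zero)
  next
    case False
    have lim: "(\<lambda>n. s / sqrt (real n)) \<longlonglongrightarrow> 0"
      by (intro tendsto_divide_0[OF tendsto_const] filterlim_at_top_imp_at_infinity
            sqrt_at_top[THEN filterlim_compose] filterlim_real_sequentially)
    have "filterlim (\<lambda>n. s / sqrt (real n)) (at 0) sequentially"
      using lim False by (auto simp: filterlim_at intro!: eventually_sequentiallyI[of 1])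
    then have "(\<lambda>n. s\<^sup>2 * e (s / sqrt (real n))) \<longlonglongrightarrow> 0"
      using filterlim_compose[OF e(1)] by (intro tendsto_mult_right_zero) blast
    moreover have "\<forall>\<^sub>F n in sequentially. cmod (char M (s / sqrt (real n)) ^ n - ?z n ^ n)
        \<le> s\<^sup>2 * e (s / sqrt (real n))"
    proof (rule eventually_sequentiallyI)
      \<comment> \<open>An n this large puts the real base into the unit disc, as
        \<open>norm_power_diff\<close> demands.\<close>
      fix n assume "n \<ge> nat \<lceil>\<sigma>\<^sup>2 * s\<^sup>2\<rceil> + 1"
      then have n: "real n \<ge> \<sigma>\<^sup>2 * s\<^sup>2" "n > 0" by linarith+
      have z: "cmod (?z n) \<le> 1"
        unfolding norm_of_real using n by (auto simp: abs_le_iff field_simps)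
      have z_eq: "?z n = 1 - (s / sqrt (real n))\<^sup>2 * \<sigma>\<^sup>2 / 2"
        using n by (simp add: power_divide field_simps)
      have "cmod (char M (s / sqrt (real n)) ^ n - ?z n ^ n) \<le> real n * cmod (char M (s / sqrt (real n)) - ?z n)"
        by (intro norm_power_diff cmod_char_le_1 z)
      also have "\<dots> \<le> real n * ((s / sqrt (real n))\<^sup>2 * e (s / sqrt (real n)))"
        unfolding z_eq by (intro mult_left_mono e(2)) auto
      also have "\<dots> = s\<^sup>2 * e (s / sqrt (real n))"
        using n by (simp add: power_divide)
      finally show "cmod (char M (s / sqrt (real n)) ^ n - ?z n ^ n) \<le> s\<^sup>2 * e (s / sqrt (real n))" .
    qed
    ultimately have "(\<lambda>n. char M (s / sqrt (real n)) ^ n - ?z n ^ n) \<longlonglongrightarrow> 0"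
      by (rule Lim_null_comparison[rotated])
    moreover have "(\<lambda>n. ?z n ^ n) \<longlonglongrightarrow> complex_of_real (exp (- (\<sigma>\<^sup>2 * s\<^sup>2 / 2)))"
      using tendsto_of_real[OF tendsto_exp_limit_sequentially[of "- (\<sigma>\<^sup>2 * s\<^sup>2 / 2)"], where 'a = complex]
      by simp
    ultimately show ?thesis
      by (rule Lim_transform[rotated])
  qed
qed

text \<open>Laplace's method: the substitution \<open>t = s / sqrt n\<close> turns the powers into a
  Gaussian limit, and the bound near 0 supplies a dominating function free of n.\<close>

lemma char_power_local:
  fixes g :: "real \<Rightarrow> complex"
  assumes [measurable]: "g \<in> borel_measurable borel" and B: "\<And>t. cmod (g t) \<le> B" and g0: "isCont g 0"
    and \<delta>: "\<delta> > 0" "\<And>t. \<bar>t\<bar> \<le> \<delta> \<Longrightarrow> cmod (char M t) \<le> exp (- (\<sigma>\<^sup>2 * t\<^sup>2 / 4))"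
  shows "(\<lambda>n. complex_of_real (sqrt (real n)) * (CLINT t|lborel. indicator {-\<delta>..\<delta>} t * g t * char M t ^ n))
     \<longlonglongrightarrow> g 0 * complex_of_real (sqrt (2 * pi) / \<sigma>)"
proof -
  note [measurable] = char_measurable
  let ?f = "\<lambda>n t. indicator {-\<delta>..\<delta>} t * g t * char M t ^ n"
  let ?w = "\<lambda>s. B * exp (- (\<sigma>\<^sup>2 * s\<^sup>2 / 4))"
  have gauss: "integrable lborel (\<lambda>s. exp (- (\<sigma>\<^sup>2 * s\<^sup>2 / 4)))"
    using has_bochner_integral_gaussian[of "\<sigma> / sqrt 2"] \<sigma>_pos
    by (auto simp: has_bochner_integral_iff power_divide)
  \<comment> \<open>The index \<open>Suc n\<close> keeps the scaling factor nonzero; the shape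
    \<open>0 + c * s\<close> is that of the affine substitution rule.\<close>
  have "(\<lambda>n. CLINT s|lborel. ?f (Suc n) (0 + 1 / sqrt (real (Suc n)) * s))
     \<longlonglongrightarrow> (CLINT s|lborel. g 0 * exp (- (\<sigma>\<^sup>2 * s\<^sup>2 / 2)))"
  proof (rule integral_dominated_convergence[where w = ?w])
    show "AE s in lborel. (\<lambda>n. ?f (Suc n) (0 + 1 / sqrt (real (Suc n)) * s)) \<longlonglongrightarrow> g 0 * exp (- (\<sigma>\<^sup>2 * s\<^sup>2 / 2))"
    proof (intro AE_I2)
      fix s :: real
      have lim: "(\<lambda>n. s / sqrt (real n)) \<longlonglongrightarrow> 0"
        by (intro tendsto_divide_0[OF tendsto_const] filterlim_at_top_imp_at_infinity
              sqrt_at_top[THEN filterlim_compose] filterlim_real_sequentially)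
      have "(\<lambda>n. g (s / sqrt (real n)) * char M (s / sqrt (real n)) ^ n) \<longlonglongrightarrow> g 0 * exp (- (\<sigma>\<^sup>2 * s\<^sup>2 / 2))"
        by (intro tendsto_mult char_power_tendsto isCont_tendsto_compose[OF g0 lim])
      moreover have "\<forall>\<^sub>F n in sequentially. g (s / sqrt (real n)) * char M (s / sqrt (real n)) ^ n = ?f n (s / sqrt (real n))"
      proof -
        have "\<forall>\<^sub>F n in sequentially. \<bar>s / sqrt (real n)\<bar> < \<delta>"
          using tendstoD[OF lim \<delta>(1)] by (simp add: dist_real_def)
        then show ?thesis
          by eventually_elim (simp only: indicator_def abs_less_iff atLeastAtMost_iff, simp)
      qed
      ultimately have "(\<lambda>n. ?f n (s / sqrt (real n))) \<longlonglongrightarrow> g 0 * exp (- (\<sigma>\<^sup>2 * s\<^sup>2 / 2))"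
        by (rule Lim_transform_eventually)
      from LIMSEQ_Suc[OF this]
      show "(\<lambda>n. ?f (Suc n) (0 + 1 / sqrt (real (Suc n)) * s)) \<longlonglongrightarrow> g 0 * exp (- (\<sigma>\<^sup>2 * s\<^sup>2 / 2))"
        by simp
    qed
    show "AE s in lborel. norm (?f (Suc n) (0 + 1 / sqrt (real (Suc n)) * s)) \<le> ?w s" for n
    proof (intro AE_I2)
      fix s :: real
      let ?t = "0 + 1 / sqrt (real (Suc n)) * s"
      show "norm (?f (Suc n) ?t) \<le> ?w s"
      proof (cases "\<bar>?t\<bar> \<le> \<delta>")
        case True
        have "cmod (char M ?t) ^ Suc n \<le> exp (- (\<sigma>\<^sup>2 * ?t\<^sup>2 / 4)) ^ Suc n"
          using True by (intro power_mono \<delta>) auto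
        also have "\<dots> = exp (real (Suc n) * (- (\<sigma>\<^sup>2 * ?t\<^sup>2 / 4)))"
          by (rule exp_of_nat_mult[symmetric])
        also have "real (Suc n) * (- (\<sigma>\<^sup>2 * ?t\<^sup>2 / 4)) = - (\<sigma>\<^sup>2 * s\<^sup>2 / 4)"
          by (simp add: power_divide del: of_nat_Suc)
        finally have "cmod (char M ?t) ^ Suc n \<le> exp (- (\<sigma>\<^sup>2 * s\<^sup>2 / 4))" .
        moreover have "norm (?f (Suc n) ?t) \<le> cmod (g ?t) * cmod (char M ?t) ^ Suc n"
          by (simp add: norm_mult norm_power indicator_def)
        moreover have "\<dots> \<le> cmod (g ?t) * exp (- (\<sigma>\<^sup>2 * s\<^sup>2 / 4))"
          using calculation(1) by (intro mult_left_mono) auto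
        moreover have "\<dots> \<le> ?w s" by (intro mult_right_mono B) auto
        ultimately show ?thesis by linarith
      next
        case False
        then have *: "?f (Suc n) ?t = 0" by (auto simp: indicator_def)
        have "0 \<le> B" using B[of 0] norm_ge_zero order_trans by blast
        then show ?thesis unfolding * by simp
      qed
    qed
    show "integrable lborel ?w" using gauss by simp
  qed simp_all
  moreover have "complex_of_real (sqrt (real (Suc n))) * (CLINT t|lborel. ?f (Suc n) t)
      = (CLINT s|lborel. ?f (Suc n) (0 + 1 / sqrt (real (Suc n)) * s))" for n
    by (subst lborel_integral_real_affine[where c = "1 / sqrt (real (Suc n))" and t = 0])
      (simp_all add: scaleR_conv_of_real field_simps del: of_nat_Suc)
  moreover have "(CLINT s|lborel. g 0 * complex_of_real (exp (- (\<sigma>\<^sup>2 * s\<^sup>2 / 2)))) = g 0 * complex_of_real (sqrt (2 * pi) / \<sigma>)"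
    using has_bochner_integral_gaussian[OF \<sigma>_pos]
    by (simp only: integral_mult_right_zero integral_complex_of_real has_bochner_integral_iff)
  ultimately have "(\<lambda>n. complex_of_real (sqrt (real (Suc n))) * (CLINT t|lborel. ?f (Suc n) t))
      \<longlonglongrightarrow> g 0 * complex_of_real (sqrt (2 * pi) / \<sigma>)" by (simp del: of_nat_Suc)
  then show ?thesis by (subst filterlim_sequentially_Suc[symmetric]) 
qed

text \<open>On the compact set \<open>\<delta> \<le> |t| \<le> a\<close> the continuous modulus
  attains its maximum, so the pointwise strict bound becomes a uniform \<rho> < 1, and geometric
  decay beats \<open>sqrt n\<close>.\<close>

lemma char_power_tail:
  fixes g :: "real \<Rightarrow> complex"
  assumes [measurable]: "g \<in> borel_measurable borel" and B: "\<And>t. cmod (g t) \<le> B"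
    and supp: "\<And>t. \<bar>t\<bar> > a \<Longrightarrow> g t = 0" and a: "\<And>t. 0 < \<bar>t\<bar> \<Longrightarrow> \<bar>t\<bar> \<le> a \<Longrightarrow> cmod (char M t) < 1"
    and \<delta>: "\<delta> > 0"
  shows "(\<lambda>n. complex_of_real (sqrt (real n)) * (CLINT t|lborel. indicator (- {-\<delta>..\<delta>}) t * g t * char M t ^ n)) \<longlonglongrightarrow> 0"
proof -
  note [measurable] = char_measurable
  have B0: "0 \<le> B" using B[of 0] norm_ge_zero order_trans by blast
  obtain \<rho> where \<rho>: "0 \<le> \<rho>" "\<rho> < 1" "\<And>t. \<delta> \<le> \<bar>t\<bar> \<Longrightarrow> \<bar>t\<bar> \<le> a \<Longrightarrow> cmod (char M t) \<le> \<rho>"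
  proof (cases "\<delta> \<le> a")
    case True
    let ?S = "{-a..-\<delta>} \<union> {\<delta>..a}"
    have "\<exists>x\<in>?S. \<forall>y\<in>?S. cmod (char M y) \<le> cmod (char M x)"
      using True by (intro continuous_attains_sup continuous_intros compact_Un)
        (auto intro!: continuous_at_imp_continuous_on continuous_intros isCont_char)
    then obtain x where x: "x \<in> ?S" "\<And>y. y \<in> ?S \<Longrightarrow> cmod (char M y) \<le> cmod (char M x)" by blast
    have "cmod (char M x) < 1" using x(1) \<delta> by (intro a) auto
    moreover have "cmod (char M t) \<le> cmod (char M x)" if "\<delta> \<le> \<bar>t\<bar>" "\<bar>t\<bar> \<le> a" for t
      using that by (intro x(2)) auto
    ultimately show ?thesis using that[of "cmod (char M x)"] by auto
  next
    case False
    \<comment> \<open>No t qualifies here, so any admissible \<rho> will do.\<close>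
    then show ?thesis using that[of 0] by auto
  qed
  have bound: "norm (complex_of_real (sqrt (real n)) * (CLINT t|lborel. indicator (- {-\<delta>..\<delta>}) t * g t * char M t ^ n))
     \<le> \<bar>a\<bar> * 2 * B * (sqrt (real n) * \<rho> ^ n)" for n
  proof -
    have "norm (CLINT t|lborel. indicator (- {-\<delta>..\<delta>}) t * g t * char M t ^ n)
      \<le> (\<integral>t. norm (indicator (- {-\<delta>..\<delta>}) t * g t * char M t ^ n) \<partial>lborel)"
      by (rule integral_norm_bound)
    also have "\<dots> \<le> (\<integral>t. (B * \<rho> ^ n) * indicator {-\<bar>a\<bar>..\<bar>a\<bar>} t \<partial>lborel)"
    proof (rule integral_mono')
      fix t :: real
      show "norm (indicator (- {-\<delta>..\<delta>}) t * g t * char M t ^ n) \<le> (B * \<rho> ^ n) * indicator {-\<bar>a\<bar>..\<bar>a\<bar>} t"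
      proof (cases "\<bar>t\<bar> \<le> a \<and> \<not> \<bar>t\<bar> \<le> \<delta>")
        case True
        have "norm (g t * char M t ^ n) \<le> B * \<rho> ^ n"
          unfolding norm_mult norm_power using True B0 by (intro mult_mono B power_mono \<rho>) auto
        then show ?thesis using True by (auto simp: indicator_def norm_mult)
      next
        case False
        then have *: "indicator (- {-\<delta>..\<delta>}) t * g t = 0" using supp[of t] by (cases "\<bar>t\<bar> \<le> a") (auto simp: indicator_def)
        show ?thesis unfolding * using B0 \<rho>(1) by simp
      qed
    qed (use B0 \<rho> in auto)
    also have "\<dots> = \<bar>a\<bar> * 2 * B * \<rho> ^ n" by simp
    finally have "norm (CLINT t|lborel. indicator (- {-\<delta>..\<delta>}) t * g t * char M t ^ n) \<le> \<bar>a\<bar> * 2 * B * \<rho> ^ n" .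
    from mult_left_mono[OF this, of "sqrt (real n)"] show ?thesis
      by (simp add: norm_mult mult_ac)
  qed
  have "(\<lambda>n. real n * \<rho> ^ n) \<longlonglongrightarrow> 0"
    using powser_times_n_limit_0[of \<rho>] \<rho> by simp
  then have "(\<lambda>n. sqrt (real n) * \<rho> ^ n) \<longlonglongrightarrow> 0"
  proof (rule Lim_null_comparison[rotated])
    show "\<forall>\<^sub>F n in sequentially. norm (sqrt (real n) * \<rho> ^ n) \<le> real n * \<rho> ^ n"
    proof (rule eventually_sequentiallyI[of 1])
      fix n :: nat assume n: "1 \<le> n"
      have "sqrt (real n) \<le> real n" using n by (intro real_le_lsqrt) (auto simp: power2_eq_square)
      then show "norm (sqrt (real n) * \<rho> ^ n) \<le> real n * \<rho> ^ n"
        using \<rho>(1) by (simp add: abs_mult mult_right_mono)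
    qed
  qed
  then have "(\<lambda>n. \<bar>a\<bar> * 2 * B * (sqrt (real n) * \<rho> ^ n)) \<longlonglongrightarrow> 0"
    by (intro tendsto_mult_right_zero)
  then show ?thesis
    by (rule Lim_null_comparison[rotated]) (use bound in auto)
qed

text \<open>The common source of all local limits below. The modulus is controlled only on the
  support of g, which admits lattice laws too: their characteristic functions return to modulus 1,
  but beyond the chosen \<open>a\<close>.\<close>

lemma char_power_laplace:
  fixes g :: "real \<Rightarrow> complex"
  assumes [measurable]: "g \<in> borel_measurable borel" and B: "\<And>t. cmod (g t) \<le> B" and g0: "isCont g 0"
    and supp: "\<And>t. \<bar>t\<bar> > a \<Longrightarrow> g t = 0" and a: "\<And>t. 0 < \<bar>t\<bar> \<Longrightarrow> \<bar>t\<bar> \<le> a \<Longrightarrow> cmod (char M t) < 1"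
  shows "(\<lambda>n. complex_of_real (sqrt (real n)) * (CLINT t|lborel. g t * char M t ^ n))
     \<longlonglongrightarrow> g 0 * complex_of_real (sqrt (2 * pi) / \<sigma>)"
proof -
  note [measurable] = char_measurable
  obtain \<delta> where \<delta>: "\<delta> > 0" "\<And>t. \<bar>t\<bar> \<le> \<delta> \<Longrightarrow> cmod (char M t) \<le> exp (- (\<sigma>\<^sup>2 * t\<^sup>2 / 4))"
    using char_gaussian_bound by blast
  have B0: "0 \<le> B" using B[of 0] norm_ge_zero order_trans by blast
  have int: "integrable lborel (\<lambda>t. g t * char M t ^ n)" for n
  proof (rule integrableI_bounded_set[where A = "{-\<bar>a\<bar>..\<bar>a\<bar>}" and B = B])
    show "AE x in lborel. x \<in> {-\<bar>a\<bar>..\<bar>a\<bar>} \<longrightarrow> cmod (g x * char M x ^ n) \<le> B"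
      using mult_mono[OF B power_le_one] cmod_char_le_1 B0 by (auto simp: norm_mult norm_power)
    show "AE x in lborel. x \<notin> {-\<bar>a\<bar>..\<bar>a\<bar>} \<longrightarrow> g x * char M x ^ n = 0"
      using supp by (intro AE_I2) (force)
    show "emeasure lborel {- \<bar>a\<bar>..\<bar>a\<bar>} < \<infinity>" by (simp add: emeasure_lborel_Icc_eq)
  qed auto
  have int2: "integrable lborel (\<lambda>t. indicator S t * g t * char M t ^ n)" if [measurable]: "S \<in> sets borel" for n S
    by (rule Bochner_Integration.integrable_bound[OF int[of n]]) (auto simp: indicator_def)
  have "(CLINT t|lborel. g t * char M t ^ n) = (CLINT t|lborel. indicator {-\<delta>..\<delta>} t * g t * char M t ^ n)
      + (CLINT t|lborel. indicator (- {-\<delta>..\<delta>}) t * g t * char M t ^ n)" for n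
    by (subst Bochner_Integration.integral_add[symmetric])
      (auto intro!: int2 Bochner_Integration.integral_cong, auto simp: indicator_def)
  then show ?thesis
    using tendsto_add[OF char_power_local[OF assms(1) B g0 \<delta>] char_power_tail[OF assms(1) B supp a \<delta>(1)]]
    by (simp add: distrib_left)
qed

end

section \<open>The Fejer kernel\<close>

lemma (in real_distribution) fourier_parseval:
  fixes g :: "real \<Rightarrow> complex"
  assumes g: "integrable lborel g"
  shows "(CLINT x|M. (CLINT t|lborel. g t * iexp (t * x))) = (CLINT t|lborel. g t * char M t)"
proof -
  interpret pair_sigma_finite M lborel by standard
  have [measurable]: "g \<in> borel_measurable borel"
    using borel_measurable_integrable[OF g] by simp
  have "integrable (M \<Otimes>\<^sub>M lborel) (\<lambda>(x, t). g t * iexp (t * x))"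
    by (rule Fubini_integrable)
      (use g in \<open>auto simp: norm_mult split_beta intro!: Bochner_Integration.integrable_bound[OF g] AE_I2\<close>)
  from Fubini_integral[OF this] show ?thesis
    by (simp add: char_def)
qed

definition tent :: "real \<Rightarrow> real \<Rightarrow> real" where
  "tent A t = max 0 (A - \<bar>t\<bar>)"

text \<open>This is \<open>(sin (A x / 2) / (x / 2))^2\<close>, continuously extended to 0: the
  Fourier transform of \<open>tent A\<close>. Being nonnegative, it can serve as a density.\<close>

definition fejer :: "real \<Rightarrow> real \<Rightarrow> real" where
  "fejer A x = (if x = 0 then A\<^sup>2 else 2 * (1 - cos (A * x)) / x\<^sup>2)"

lemma tent_measurable [measurable]: "tent A \<in> borel_measurable borel"
  unfolding tent_def by measurable

lemma fejer_measurable [measurable]: "fejer A \<in> borel_measurable borel"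
  unfolding fejer_def by measurable

lemma tent_bounds: "0 \<le> tent A t" "A \<ge> 0 \<Longrightarrow> tent A t \<le> A"
  by (auto simp: tent_def)

lemma tent_minus [simp]: "tent A (- t) = tent A t"
  by (simp add: tent_def)

lemma tent_eq_0: "\<bar>t\<bar> \<ge> A \<Longrightarrow> tent A t = 0"
  by (simp add: tent_def)

lemma isCont_tent: "isCont (tent A) t"
  unfolding tent_def by (intro continuous_intros)

lemma integrable_tent: "integrable lborel (tent A)"
proof (rule integrableI_bounded_set[where A = "{-\<bar>A\<bar>..\<bar>A\<bar>}" and B = "\<bar>A\<bar>"])
  show "emeasure lborel {- \<bar>A\<bar>..\<bar>A\<bar>} < \<infinity>" by (simp add: emeasure_lborel_Icc_eq)
qed (auto simp: tent_def)

lemma fejer_nonneg: "0 \<le> fejer A x"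
  by (simp add: fejer_def)

lemma fejer_fourier:
  assumes A: "A > 0"
  shows "(CLINT t|lborel. tent A t * iexp (t * x)) = fejer A x"
proof -
  let ?h = "\<lambda>t. complex_of_real (tent A t) * iexp (t * x)"
  have "integrable lborel ?h"
    by (rule Bochner_Integration.integrable_bound[OF integrable_tent[of A]]) (auto simp: norm_mult)
  then have I: "(?h has_integral (CLINT t|lborel. ?h t)) UNIV"
    by (rule has_integral_integral_lborel)
  have "(?h has_integral fejer A x) {-A..A}"
  proof (cases "x = 0")
    case True
    have "((\<lambda>t. complex_of_real (A + t)) has_integral (of_real (A * 0 + 0\<^sup>2 / 2) - of_real (A * (-A) + (-A)\<^sup>2 / 2))) {-A..0}"
      using A by (intro fundamental_theorem_of_calculus[where f = "\<lambda>t. of_real (A * t + t\<^sup>2 / 2)"] has_vector_derivative_of_real)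
        (auto intro!: derivative_eq_intros simp: has_real_derivative_iff_has_vector_derivative[symmetric])
    then have 1: "(?h has_integral (of_real (A\<^sup>2/2))) {-A..0}"
      by (rule has_integral_eq_rhs[OF has_integral_eq[rotated]]) (auto simp: True tent_def power2_eq_square)
    have "((\<lambda>t. complex_of_real (A - t)) has_integral (of_real (A * A - A\<^sup>2 / 2) - of_real (A * 0 - 0\<^sup>2 / 2))) {0..A}"
      using A by (intro fundamental_theorem_of_calculus[where f = "\<lambda>t. of_real (A * t - t\<^sup>2 / 2)"] has_vector_derivative_of_real)
        (auto intro!: derivative_eq_intros simp: has_real_derivative_iff_has_vector_derivative[symmetric])
    then have 2: "(?h has_integral (of_real (A\<^sup>2/2))) {0..A}"
      by (rule has_integral_eq_rhs[OF has_integral_eq[rotated]]) (auto simp: True tent_def power2_eq_square)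
    show ?thesis
      using has_integral_combine[OF _ _ 1 2] A by (simp add: fejer_def True flip: of_real_add)
  next
    case False
    define E where "E t = iexp (t * x)" for t
    have E0: "E 0 = 1" by (simp add: E_def)
    have dE: "(E has_vector_derivative (\<i> * x * E t)) (at t within S)" for t S
    proof -
      have "((iexp \<circ> (\<lambda>t. t * x)) has_vector_derivative x *\<^sub>R (\<i> * iexp (t * x))) (at t within S)"
        by (intro vector_diff_chain_within has_vector_derivative_iexp)
           (auto intro!: derivative_eq_intros simp: has_real_derivative_iff_has_vector_derivative[symmetric])
      then show ?thesis unfolding E_def[abs_def] by (simp add: comp_def scaleR_conv_of_real mult_ac)
    qed
    \<comment> \<open>Integration by parts provides the antiderivative; its second term is positive
      because \<open>- 1 / (i x)^2 = 1 / x^2\<close>. The division by x is why \<open>x = 0\<close>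
      was split off.\<close>
    have "((\<lambda>t. complex_of_real (A + t) * E t) has_integral
        ((of_real (A + 0) * E 0 / (\<i> * x) + E 0 / x\<^sup>2) - (of_real (A + -A) * E (-A) / (\<i> * x) + E (-A) / x\<^sup>2))) {-A..0}"
      using A by (intro fundamental_theorem_of_calculus)
        (auto intro!: derivative_eq_intros dE has_vector_derivative_of_real simp: False field_simps power2_eq_square)
    then have 1: "(?h has_integral (A / (\<i> * x) + 1 / x\<^sup>2 - E (-A) / x\<^sup>2)) {-A..0}"
      by (rule has_integral_eq_rhs[OF has_integral_eq[rotated]]) (auto simp: tent_def E0, simp_all add: E_def)
    have "((\<lambda>t. complex_of_real (A - t) * E t) has_integral
        ((of_real (A - A) * E A / (\<i> * x) - E A / x\<^sup>2) - (of_real (A - 0) * E 0 / (\<i> * x) - E 0 / x\<^sup>2))) {0..A}"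
      using A by (intro fundamental_theorem_of_calculus)
        (auto intro!: derivative_eq_intros dE has_vector_derivative_of_real simp: False field_simps power2_eq_square)
    then have 2: "(?h has_integral (- (A / (\<i> * x)) + 1 / x\<^sup>2 - E A / x\<^sup>2)) {0..A}"
      by (rule has_integral_eq_rhs[OF has_integral_eq[rotated]]) (auto simp: tent_def E0, simp_all add: E_def)
    have "E A + E (-A) = 2 * cos (A * x)"
      by (simp add: E_def complex_eq_iff Re_exp Im_exp)
    then have "2 / x\<^sup>2 - (E A + E (-A)) / x\<^sup>2 = fejer A x"
      using False by (simp add: fejer_def diff_divide_distrib[symmetric] right_diff_distrib)
    then have "(A / (\<i> * x) + 1 / x\<^sup>2 - E (-A) / x\<^sup>2) + (- (A / (\<i> * x)) + 1 / x\<^sup>2 - E A / x\<^sup>2) = fejer A x"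
      by (simp add: add_divide_distrib algebra_simps)
    with has_integral_combine[OF _ _ 1 2] A show ?thesis by simp
  qed
  then have "(?h has_integral fejer A x) UNIV"
    by (rule has_integral_on_superset) (auto simp: tent_def)
  with I show ?thesis by (rule has_integral_unique)
qed

text \<open>The cubic Taylor polynomial of \<open>iexp y\<close> has real part
  \<open>1 - y^2 / 2\<close>, the cubic term being imaginary. For \<open>|y| \<le> 1\<close> the
  remainder costs \<open>2 (1 - cos y)\<close> at most \<open>y^2 / 12\<close> out of
  \<open>y^2\<close>.\<close>

lemma fejer_lower_bound:
  assumes "A > 0" "\<bar>A * x\<bar> \<le> 1"
  shows "fejer A x \<ge> A\<^sup>2 / 2"
proof (cases "x = 0")
  case False
  let ?y = "A * x"
  have "\<bar>Re (iexp ?y - (\<Sum>k\<le>3. (\<i> * ?y)^k / fact k))\<bar> \<le> \<bar>?y\<bar>^4 / 24"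
    using order_trans[OF abs_Re_le_cmod iexp_approx1[of ?y 3]] by (simp add: fact_numeral)
  moreover have "Re (iexp ?y - (\<Sum>k\<le>3. (\<i> * ?y)^k / fact k)) = cos ?y - (1 - ?y\<^sup>2 / 2)"
    by (simp add: numeral_eq_Suc Re_exp power2_eq_square Re_divide)
  moreover have "\<bar>?y\<bar>^4 \<le> \<bar>?y\<bar>\<^sup>2" using assms(2) by (intro power_decreasing) auto
  ultimately have "\<bar>cos ?y - (1 - ?y\<^sup>2 / 2)\<bar> \<le> ?y\<^sup>2 / 24"
    by simp
  then have "2 * (1 - cos ?y) \<ge> ?y\<^sup>2 / 2"
    using zero_le_power2[of ?y] unfolding abs_le_iff by argo
  then have "2 * (1 - cos ?y) / x\<^sup>2 \<ge> (?y\<^sup>2 / 2) / x\<^sup>2"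
    by (intro divide_right_mono) auto
  then show ?thesis using False by (simp add: fejer_def power_mult_distrib)
qed (simp add: fejer_def)

text \<open>The transform of a nonnegative function is largest in modulus at 0, where it equals the
  mass of the tent.\<close>

lemma fejer_upper_bound:
  assumes "A > 0"
  shows "fejer A x \<le> A\<^sup>2"
proof -
  have "cmod (CLINT t|lborel. tent A t * iexp (t * x)) \<le> (\<integral>t. tent A t \<partial>lborel)"
    by (rule order_trans[OF integral_norm_bound]) (simp add: norm_mult tent_bounds)
  moreover have "(\<integral>t. tent A t \<partial>lborel) = A\<^sup>2"
  proof -
    have "complex_of_real (\<integral>t. tent A t \<partial>lborel) = fejer A 0"
      using fejer_fourier[OF assms, of 0] by (simp add: integral_complex_of_real)
    then have "complex_of_real (\<integral>t. tent A t \<partial>lborel) = complex_of_real (A\<^sup>2)"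
      by (simp add: fejer_def)
    then show ?thesis by (simp only: of_real_eq_iff)
  qed
  ultimately show ?thesis using fejer_nonneg[of A x] by (simp only: fejer_fourier[OF assms] norm_of_real abs_of_nonneg)
qed

text \<open>Modulating the kernel by \<open>iexp (s * x)\<close> shifts the tent by s. All s are
  wanted, because Levy's theorem asks for the characteristic function of the weighted law at every
  frequency.\<close>

lemma (in real_distribution) fejer_parseval:
  assumes A: "A > 0"
  shows "(CLINT x|M. fejer A x * iexp (s * x)) = (CLINT t|lborel. tent A (t - s) * char M t)"
proof -
  have int: "integrable lborel (\<lambda>t. complex_of_real (tent A (t - s)))"
    using lborel_integrable_real_affine[OF integrable_tent[of A], of 1 "-s"] by simp
  have "(CLINT t|lborel. tent A (t - s) * iexp (t * x)) = fejer A x * iexp (s * x)" for x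
  proof -
    have "(CLINT t|lborel. tent A (t - s) * iexp (t * x)) = (CLINT t|lborel. iexp (s * x) * (tent A t * iexp (t * x)))"
      by (subst lborel_integral_real_affine[where c = 1 and t = s])
         (simp_all add: distrib_right distrib_left exp_add mult_ac)
    also have "\<dots> = iexp (s * x) * fejer A x"
      by (subst integral_mult_right_zero) (simp only: fejer_fourier[OF A])
    finally show ?thesis by (simp add: mult_ac)
  qed
  with fourier_parseval[OF int] show ?thesis by simp
qed

section \<open>Uniform concentration of sums\<close>

context centered_distribution
begin

text \<open>Translation by y multiplies the characteristic function by a factor of modulus 1, so a
  bound that sees only moduli is uniform in y. Choosing the tent supported in
  \<open>{-\<delta>..\<delta>}\<close>, where the Gaussian bound holds, makes the lattice structure
  irrelevant. N enters only through its characteristic function, so that sums over any n coordinates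
  qualify.\<close>

lemma uniform_concentration:
  "\<exists>l>0. \<exists>C\<ge>0. \<forall>N n y. n > 0 \<longrightarrow> real_distribution N \<longrightarrow> (\<forall>t. char N t = char M t ^ n)
     \<longrightarrow> measure N {y..y + l} \<le> C / sqrt (real n)"
proof -
  obtain \<delta> where \<delta>: "\<delta> > 0" "\<And>t. \<bar>t\<bar> \<le> \<delta> \<Longrightarrow> cmod (char M t) \<le> exp (- (\<sigma>\<^sup>2 * t\<^sup>2 / 4))"
    using char_gaussian_bound by blast
  \<comment> \<open>\<open>2 / \<delta>\<close> is the height \<delta> of the tent over the lower
    bound \<open>\<delta>^2 / 2\<close> of the kernel; the rest is the integral of the Gaussian
    bound, freed of its factor \<open>1 / sqrt n\<close>.\<close>
  define C where "C = 2 / \<delta> * (sqrt (2 * pi) / (\<sigma> / sqrt 2))"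
  have "measure N {y..y + 1 / \<delta>} \<le> C / sqrt (real n)"
    if n: "n > 0" and "real_distribution N" and ch: "\<And>t. char N t = char M t ^ n" for N n y
  proof -
    interpret N: real_distribution N by fact
    let ?E = "\<lambda>x. iexp (x * (- y))"
    define N' where "N' = distr N borel (\<lambda>x. x - y)"
    interpret N': real_distribution N'
      unfolding N'_def by (rule N.real_distribution_distr) simp
    have char': "char N' t = iexp (- (t * y)) * char N t" for t
      unfolding N'_def char_def
      by (subst integral_distr, simp, simp, subst integral_mult_right_zero[symmetric])
         (simp add: exp_add[symmetric] algebra_simps)
    have bound: "cmod (char N' t) \<le> exp (- ((\<sigma> / sqrt 2 * sqrt n)\<^sup>2 * t\<^sup>2 / 2))" if "\<bar>t\<bar> \<le> \<delta>" for t
    proof -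
      have "cmod (char N' t) = cmod (char M t) ^ n"
        by (simp add: char' ch norm_mult norm_power)
      also have "\<dots> \<le> exp (- (\<sigma>\<^sup>2 * t\<^sup>2 / 4)) ^ n"
        by (intro power_mono \<delta>(2) that) auto
      also have "\<dots> = exp (- ((\<sigma> / sqrt 2 * sqrt n)\<^sup>2 * t\<^sup>2 / 2))"
        by (simp add: exp_of_nat_mult[symmetric] power_mult_distrib power_divide)
      finally show ?thesis .
    qed
    have gauss: "has_bochner_integral lborel (\<lambda>t. exp (- ((\<sigma> / sqrt 2 * sqrt n)\<^sup>2 * t\<^sup>2 / 2)))
        (sqrt (2 * pi) / (\<sigma> / sqrt 2 * sqrt n))"
      using \<sigma>_pos n by (intro has_bochner_integral_gaussian) auto
    have fint: "integrable N' (fejer \<delta>)"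
      using fejer_upper_bound[OF \<delta>(1)] fejer_nonneg
      by (intro N'.integrable_const_bound[where B = "\<delta>\<^sup>2"]) auto
    have "\<delta>\<^sup>2 / 2 * measure N {y..y + 1 / \<delta>} \<le> \<delta>\<^sup>2 / 2 * measure N' {-1/\<delta>..1/\<delta>}"
    proof -
      have "measure N' {-1/\<delta>..1/\<delta>} = measure N ((\<lambda>x. x - y) -` {-1/\<delta>..1/\<delta>} \<inter> space N)"
        unfolding N'_def by (rule measure_distr) auto
      also have "(\<lambda>x. x - y) -` {-1/\<delta>..1/\<delta>} \<inter> space N = {y - 1/\<delta>..y + 1/\<delta>}"
        by (auto simp: N.space_eq_univ)
      finally show ?thesis using \<delta>(1) by (auto intro!: mult_left_mono N.finite_measure_mono)
    qed
    also have "\<dots> = (\<integral>x. \<delta>\<^sup>2 / 2 * indicator {-1/\<delta>..1/\<delta>} x \<partial>N')" by simp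
    also have "\<dots> \<le> (\<integral>x. fejer \<delta> x \<partial>N')"
    proof (rule integral_mono)
      fix x show "\<delta>\<^sup>2 / 2 * indicator {-1/\<delta>..1/\<delta>} x \<le> fejer \<delta> x"
        using fejer_lower_bound[OF \<delta>(1), of x] fejer_nonneg[of \<delta> x] \<delta>(1)
        by (auto simp: indicator_def abs_mult abs_le_iff field_simps)
    qed (auto intro!: fint N'.integrable_const_bound[where B = "\<delta>\<^sup>2 / 2"] simp: indicator_def)
    also have "\<dots> = cmod (CLINT x|N'. complex_of_real (fejer \<delta> x))"
      by (subst integral_complex_of_real) (simp add: fejer_nonneg del: of_real_eq_iff)
    also have "\<dots> = cmod (CLINT t|lborel. tent \<delta> t * char N' t)"
      using N'.fejer_parseval[OF \<delta>(1), of 0] by simp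
    also have "\<dots> \<le> (\<integral>t. norm (tent \<delta> t * char N' t) \<partial>lborel)"
      by (rule integral_norm_bound)
    also have "\<dots> \<le> (\<integral>t. \<delta> * exp (- ((\<sigma> / sqrt 2 * sqrt n)\<^sup>2 * t\<^sup>2 / 2)) \<partial>lborel)"
    proof (rule integral_mono')
      fix t
      show "norm (tent \<delta> t * char N' t) \<le> \<delta> * exp (- ((\<sigma> / sqrt 2 * sqrt n)\<^sup>2 * t\<^sup>2 / 2))"
      proof (cases "\<bar>t\<bar> \<le> \<delta>")
        case True
        then show ?thesis unfolding norm_mult norm_of_real
          using \<delta>(1) tent_bounds[of \<delta> t] by (intro mult_mono bound) auto
      next
        case False
        then have "tent \<delta> t = 0" by (intro tent_eq_0) auto
        then show ?thesis using \<delta>(1) by simp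
      qed
    qed (use gauss \<delta>(1) in \<open>auto simp: has_bochner_integral_iff\<close>)
    also have "\<dots> = \<delta> * (sqrt (2 * pi) / (\<sigma> / sqrt 2 * sqrt n))"
      using gauss by (simp only: integral_mult_right_zero has_bochner_integral_iff)
    finally have "2 / \<delta>\<^sup>2 * (\<delta>\<^sup>2 / 2 * measure N {y..y + 1 / \<delta>}) \<le> 2 / \<delta>\<^sup>2 * (\<delta> * (sqrt (2 * pi) / (\<sigma> / sqrt 2 * sqrt n)))"
      by (intro mult_left_mono) auto
    then show ?thesis
      using \<delta>(1) by (simp add: C_def power2_eq_square mult_ac)
  qed
  moreover have "C \<ge> 0" using \<delta>(1) \<sigma>_pos by (simp add: C_def)
  moreover have "1 / \<delta> > 0" using \<delta>(1) by simp
  ultimately show ?thesis by (intro exI[of _ "1 / \<delta>"] exI[of _ C]) blast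
qed

text \<open>The exponential weight extends the bound from a window to a half-line without losing
  uniformity in y; the denominator \<open>1 - exp (- \<theta> * l)\<close> is the geometric series
  over successive windows.\<close>

lemma uniform_exp_tail:
  assumes \<theta>: "\<theta> > 0"
  shows "\<exists>C\<ge>0. \<forall>N n y. n > 0 \<longrightarrow> real_distribution N \<longrightarrow> (\<forall>t. char N t = char M t ^ n)
     \<longrightarrow> (\<integral>x. indicator {y..} x * exp (- \<theta> * (x - y)) \<partial>N) \<le> C / sqrt (real n)"
proof -
  from uniform_concentration obtain l C where l: "l > 0" and C: "C \<ge> 0" and
    conc': "\<forall>N n y. n > 0 \<longrightarrow> real_distribution N \<longrightarrow> (\<forall>t. char N t = char M t ^ n) \<longrightarrow> measure N {y..y + l} \<le> C / sqrt (real n)"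
    by (elim exE conjE)
  let ?q = "exp (- \<theta> * l)"
  have q: "?q < 1" using l \<theta> by simp
  have "(\<integral>x. indicator {y..} x * exp (- \<theta> * (x - y)) \<partial>N) \<le> (C / (1 - ?q)) / sqrt (real n)"
    if n: "n > 0" and "real_distribution N" and ch: "\<And>t. char N t = char M t ^ n" for N n y
  proof -
    interpret N: real_distribution N by fact
    have conc: "measure N {y..y + l} \<le> C / sqrt (real n)" for y
      using conc'[rule_format, OF n \<open>real_distribution N\<close> ch] .
    define H where "H y = (\<integral>x. indicator {y..} x * exp (- \<theta> * (x - y)) \<partial>N)" for y
    have le1: "indicator {y..} x * exp (- \<theta> * (x - y)) \<le> 1" for x y :: real
      using \<theta> by (auto simp: indicator_def)
    have int: "integrable N (\<lambda>x. indicator {y..} x * exp (- \<theta> * (x - y)))" for y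
      using le1 by (intro N.integrable_const_bound[where B = 1]) auto
    \<comment> \<open>Removing the first window rescales the same integral, so the supremum bounds itself.\<close>
    have step: "H y \<le> C / sqrt n + ?q * H (y + l)" for y
    proof -
      have iw: "integrable N (indicat_real {y..y + l})"
        by (rule N.integrable_const_bound[where B = 1]) auto
      have "H y \<le> (\<integral>x. indicator {y..y + l} x + ?q * (indicator {y + l..} x * exp (- \<theta> * (x - (y + l)))) \<partial>N)"
        unfolding H_def
      proof (rule integral_mono)
        fix x
        show "indicator {y..} x * exp (- \<theta> * (x - y)) \<le> indicator {y..y + l} x + ?q * (indicator {y + l..} x * exp (- \<theta> * (x - (y + l))))"
          using \<theta> by (auto simp: indicator_def exp_add[symmetric] algebra_simps)
      qed (use int iw in auto)
      also have "\<dots> = measure N {y..y + l} + ?q * H (y + l)"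
        unfolding H_def using int iw by (subst Bochner_Integration.integral_add) auto
      finally show ?thesis using conc[of y] by linarith
    qed
    \<comment> \<open>This crude bound makes the supremum finite, so that it may be subtracted from
      both sides below.\<close>
    have H1: "H y \<le> 1" for y
      unfolding H_def using le1 by (intro N.integral_le_const int) auto
    then have bdd: "bdd_above (range H)" by (intro bdd_aboveI2)
    have "(SUP y. H y) \<le> C / sqrt n + ?q * (SUP y. H y)"
    proof (rule cSUP_least)
      fix y
      have "H (y + l) \<le> (SUP y. H y)" by (intro cSUP_upper bdd) auto
      then show "H y \<le> C / sqrt n + ?q * (SUP y. H y)"
                by (intro order_trans[OF step[of y]] add_left_mono mult_left_mono) auto
    qed simp
    then have "(SUP y. H y) * (1 - ?q) \<le> C / sqrt n" by (simp add: algebra_simps)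
    then have "(SUP y. H y) \<le> C / sqrt n / (1 - ?q)" using q by (simp only: pos_le_divide_eq diff_gt_0_iff_gt)
    moreover have "H y \<le> (SUP y. H y)" by (intro cSUP_upper bdd) auto
    ultimately show ?thesis unfolding H_def by (simp add: divide_divide_eq_left mult.commute)
  qed
  moreover have "C / (1 - ?q) \<ge> 0" using C q by simp
  ultimately show ?thesis by (intro exI[of _ "C / (1 - ?q)"]) blast
qed

text \<open>An exchange of limits: what lies beyond \<open>h * m\<close> contributes at most
  \<open>C exp (- \<theta> h m)\<close> for every n. The length h is left free so that windows can
  end on lattice points.\<close>

lemma exp_integral_limit_of_windows:
  fixes L :: "nat \<Rightarrow> real"
  assumes \<theta>: "\<theta> > 0" and h: "h > 0"
    and N: "\<And>n. real_distribution (N n)" "\<And>n t. char (N n) t = char M t ^ n"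
    and window: "\<And>m. m > 0 \<Longrightarrow> (\<lambda>n. sqrt (real n) * (\<integral>x. indicator {0..<h * real m} x * exp (- \<theta> * x) \<partial>N n)) \<longlonglongrightarrow> L m"
    and L: "L \<longlonglongrightarrow> l"
  shows "(\<lambda>n. sqrt (real n) * (\<integral>x. indicator {0..} x * exp (- \<theta> * x) \<partial>N n)) \<longlonglongrightarrow> l"
proof -
  from uniform_exp_tail[OF \<theta>] obtain C where C: "C \<ge> 0" and tail': "\<forall>N n y. n > 0 \<longrightarrow> real_distribution N \<longrightarrow>
      (\<forall>t. char N t = char M t ^ n) \<longrightarrow> (\<integral>x. indicator {y..} x * exp (- \<theta> * (x - y)) \<partial>N) \<le> C / sqrt (real n)"
    by (elim exE conjE)
  have tail: "(\<integral>x. indicator {y..} x * exp (- \<theta> * (x - y)) \<partial>N n) \<le> C / sqrt (real n)" if "n > 0" for n y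
    using tail'[rule_format, OF that N(1) N(2)] .
  define I where "I n = sqrt (real n) * (\<integral>x. indicator {0..} x * exp (- \<theta> * x) \<partial>N n)" for n
  define W where "W m n = sqrt (real n) * (\<integral>x. indicator {0..<h * real m} x * exp (- \<theta> * x) \<partial>N n)" for m n
  have diff: "\<bar>I n - W m n\<bar> \<le> exp (- \<theta> * h * m) * C" for m n
  proof (cases "n = 0")
    case False
    interpret N: real_distribution "N n" by (rule N)
    have int: "integrable (N n) (\<lambda>x. indicator S x * exp (- \<theta> * (x - y)))"
      if "S \<subseteq> {y..}" "S \<in> sets borel" for y :: real and S
      using that \<theta> by (intro N.integrable_const_bound[where B = 1] AE_I2) (auto simp: indicator_def subset_iff)
    let ?y = "h * real m"
    have y: "?y \<ge> 0" using h by simp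
    have "I n = sqrt n * (\<integral>x. indicator {0..<?y} x * exp (- \<theta> * (x - 0)) + exp (- \<theta> * ?y) * (indicator {?y..} x * exp (- \<theta> * (x - ?y))) \<partial>N n)"
      unfolding I_def using y
      by (intro arg_cong2[where f = "(*)"] Bochner_Integration.integral_cong refl) (auto simp: indicator_def exp_add[symmetric] algebra_simps)
    also have "\<dots> = sqrt n * ((\<integral>x. indicator {0..<?y} x * exp (- \<theta> * (x - 0)) \<partial>N n)
        + exp (- \<theta> * ?y) * (\<integral>x. indicator {?y..} x * exp (- \<theta> * (x - ?y)) \<partial>N n))"
      by (subst Bochner_Integration.integral_add)
        (auto intro!: int Bochner_Integration.integrable_mult_right simp only: integral_mult_right_zero subset_iff, auto)
    also have "\<dots> = W m n + exp (- \<theta> * ?y) * (sqrt n * (\<integral>x. indicator {?y..} x * exp (- \<theta> * (x - ?y)) \<partial>N n))"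
      unfolding W_def by (simp only: distrib_left mult_ac diff_zero)
    finally have eq: "I n - W m n = exp (- \<theta> * h * m) * (sqrt n * (\<integral>x. indicator {?y..} x * exp (- \<theta> * (x - ?y)) \<partial>N n))"
      by (simp add: mult_ac)
    have "sqrt n * (\<integral>x. indicator {?y..} x * exp (- \<theta> * (x - ?y)) \<partial>N n) \<le> C"
      using tail[of n ?y] False by (simp add: field_simps)
    moreover have "0 \<le> (\<integral>x. indicator {?y..} x * exp (- \<theta> * (x - ?y)) \<partial>N n)"
      by (intro integral_nonneg_AE) auto
    ultimately show ?thesis unfolding eq abs_mult
      by (intro mult_mono) (auto simp: abs_mult)
  qed (use C in \<open>simp add: I_def W_def\<close>)
  have "(\<lambda>m. exp (- \<theta> * h) ^ m) \<longlonglongrightarrow> 0"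
    using \<theta> h by (intro LIMSEQ_power_zero) auto
  then have small: "(\<lambda>m. exp (- \<theta> * h * real m) * C) \<longlonglongrightarrow> 0"
    by (intro tendsto_mult_left_zero) (simp add: exp_of_nat_mult[symmetric] mult_ac)
  show ?thesis unfolding I_def[symmetric]
  proof (rule LIMSEQ_I)
    \<comment> \<open>The window m is fixed first, using the bound uniform in n; only then is n sent
      to infinity.\<close>
    fix r :: real assume r: "r > 0"
    have "\<forall>\<^sub>F m in sequentially. exp (- \<theta> * h * real m) * C < r / 3"
      using small r by (intro order_tendstoD(2)) auto
    moreover have "\<forall>\<^sub>F m in sequentially. \<bar>L m - l\<bar> < r / 3"
      using tendstoD[OF L, of "r / 3"] r by (simp add: dist_real_def)
    moreover have "\<forall>\<^sub>F m in sequentially. m > (0::nat)" by (rule eventually_gt_at_top)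
    ultimately have "\<forall>\<^sub>F m in sequentially. exp (- \<theta> * h * real m) * C < r / 3 \<and> \<bar>L m - l\<bar> < r / 3 \<and> m > 0"
      by eventually_elim auto
    then obtain m where m: "exp (- \<theta> * h * real m) * C < r / 3" "\<bar>L m - l\<bar> < r / 3" "m > 0"
      by (auto dest: eventually_happens)
    have "W m \<longlonglongrightarrow> L m" using window[OF m(3)] by (simp add: W_def[abs_def])
    then obtain n0 where n0: "\<And>n. n \<ge> n0 \<Longrightarrow> \<bar>W m n - L m\<bar> < r / 3"
      using LIMSEQ_D[of "W m" "L m" "r / 3"] r by auto
    have "norm (I n - l) < r" if "n \<ge> n0" for n
    proof -
      have "\<bar>I n - l\<bar> \<le> \<bar>I n - W m n\<bar> + \<bar>W m n - L m\<bar> + \<bar>L m - l\<bar>" by simp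
      also have "\<dots> < r / 3 + r / 3 + r / 3"
        using diff[of n m] m(1,2) n0[OF that] by (intro add_strict_mono) linarith+
      finally show ?thesis by simp
    qed
    then show "\<exists>n0. \<forall>n\<ge>n0. norm (I n - l) < r" by blast
  qed
qed

end

section \<open>Fourier inversion of the Fejer kernel through normal laws\<close>

lemma centered_std_normal: "centered_distribution std_normal_distribution 1"
proof -
  interpret real_distribution std_normal_distribution by (rule real_dist_normal_dist)
  show ?thesis
    by unfold_locales
      (use integrable_std_normal_distribution_moment[of 2] integral_std_normal_distribution_moment_odd[of 1]
        std_normal_distribution_even_moments(1)[of 1] in \<open>auto simp: fact_2\<close>)
qed

text \<open>Inversion for the Fejer kernel is read off from the local asymptotics: the laws \<open>N(0, n)\<close>, scaled by
  \<open>sqrt n\<close>, converge to a multiple of Lebesgue measure.\<close>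

lemma fejer_gaussian:
  assumes A: "A > 0"
  shows "(\<lambda>n. CLINT x|lborel. fejer A x * iexp (s * x) * exp (- (x\<^sup>2 / (2 * real (Suc n))))) \<longlonglongrightarrow> 2 * pi * tent A s"
proof -
  interpret centered_distribution std_normal_distribution 1 by (rule centered_std_normal)
  let ?S = std_normal_distribution
  have "(\<lambda>n. complex_of_real (sqrt (real n)) * (CLINT t|lborel. tent A (t - s) * char ?S t ^ n))
      \<longlonglongrightarrow> complex_of_real (tent A (0 - s)) * complex_of_real (sqrt (2 * pi) / 1)"
  proof (rule char_power_laplace[where B = A and a = "A + \<bar>s\<bar>"])
    show "isCont (\<lambda>t. complex_of_real (tent A (t - s))) 0"
      by (intro continuous_intros isCont_o2[OF _ isCont_tent])
    show "complex_of_real (tent A (t - s)) = 0" if "A + \<bar>s\<bar> < \<bar>t\<bar>" for t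
      using that by (simp add: tent_eq_0)
    show "cmod (char ?S t) < 1" if "0 < \<bar>t\<bar>" for t
      using that by (simp add: char_std_normal_distribution)
  qed (use A tent_bounds in auto)
  \<comment> \<open>The factor \<open>sqrt (2 pi)\<close>, together with \<open>sqrt n\<close>,
    clears the normalising constant of the N(0, n) density; a second \<open>sqrt (2 pi)\<close>
    comes from the limit, hence \<open>2 pi\<close>.\<close>
  from LIMSEQ_Suc[OF tendsto_mult[OF tendsto_const[of "complex_of_real (sqrt (2 * pi))"] this]]
  have "(\<lambda>n. complex_of_real (sqrt (2 * pi)) * (complex_of_real (sqrt (real (Suc n))) * (CLINT t|lborel. tent A (t - s) * char ?S t ^ Suc n)))
      \<longlonglongrightarrow> complex_of_real (sqrt (2 * pi)) * (complex_of_real (tent A (0 - s)) * complex_of_real (sqrt (2 * pi) / 1))" .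
  moreover have "complex_of_real (sqrt (2 * pi)) * (complex_of_real (tent A (0 - s)) * complex_of_real (sqrt (2 * pi) / 1)) = 2 * pi * tent A s"
  proof -
    have "sqrt (2 * pi) * sqrt (2 * pi) = 2 * pi" by simp
    then have "sqrt (2 * pi) * (tent A (0 - s) * (sqrt (2 * pi) / 1)) = 2 * pi * tent A s"
      by (simp add: mult.left_commute mult.commute)
    then show ?thesis by (metis of_real_mult)
  qed
  moreover have "complex_of_real (sqrt (2 * pi)) * (complex_of_real (sqrt (real (Suc n))) * (CLINT t|lborel. tent A (t - s) * char ?S t ^ Suc n))
      = (CLINT x|lborel. fejer A x * iexp (s * x) * exp (- (x\<^sup>2 / (2 * real (Suc n)))))" for n
  proof -
    let ?r = "sqrt (real (Suc n))"
    have r: "?r > 0" by simp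
    define N where "N = density lborel (normal_density 0 ?r)"
    interpret N: prob_space N unfolding N_def by (rule prob_space_normal_density) (rule r)
    have N: "real_distribution N"
      by unfold_locales (simp_all add: N_def)
    interpret N: real_distribution N by (rule N)
    \<comment> \<open>N(0, n + 1) is the law of a sum of n + 1 standard normals; rescaling to the
      standard normal and its explicit characteristic function confirm it.\<close>
    have "char N t = char ?S t ^ Suc n" for t
    proof -
      have "char N t = (CLINT x|lborel. normal_density 0 ?r x *\<^sub>R iexp (t * x))"
        unfolding char_def N_def by (rule integral_density) auto
      also have "\<dots> = ?r *\<^sub>R (CLINT x|lborel. normal_density 0 ?r (0 + ?r * x) *\<^sub>R iexp (t * (0 + ?r * x)))"
        using r by (subst lborel_integral_real_affine[where c = ?r and t = 0]) auto
      also have "\<dots> = (CLINT x|lborel. std_normal_density x *\<^sub>R iexp (t * ?r * x))"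
        by (subst integral_scaleR_right[symmetric])
          (simp add: normal_density_def real_sqrt_mult power_mult_distrib mult_ac del: of_nat_Suc)
      also have "\<dots> = char ?S (t * ?r)"
        unfolding char_def by (rule integral_density[symmetric]) auto
      also have "\<dots> = char ?S t ^ Suc n"
        by (simp only: char_std_normal_distribution of_real_power[symmetric] exp_of_nat_mult[symmetric] power_mult_distrib)
           (simp del: of_nat_Suc add: mult_ac)
      finally show ?thesis .
    qed
    then have "(CLINT t|lborel. tent A (t - s) * char ?S t ^ Suc n) = (CLINT x|N. fejer A x * iexp (s * x))"
      by (simp only: N.fejer_parseval[OF A])
    also have "\<dots> = (CLINT x|lborel. normal_density 0 ?r x *\<^sub>R (fejer A x * iexp (s * x)))"
      unfolding N_def by (rule integral_density) auto
    finally have "complex_of_real (sqrt (2 * pi)) * (complex_of_real ?r * (CLINT t|lborel. tent A (t - s) * char ?S t ^ Suc n))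
       = (CLINT x|lborel. complex_of_real (sqrt (2 * pi) * ?r) * (normal_density 0 ?r x *\<^sub>R (fejer A x * iexp (s * x))))"
      by (simp only: integral_mult_right_zero of_real_mult mult.assoc)
    also have "\<dots> = (CLINT x|lborel. fejer A x * iexp (s * x) * exp (- (x\<^sup>2 / (2 * real (Suc n)))))"
    proof (intro Bochner_Integration.integral_cong refl)
      fix x
      have "sqrt (2 * pi) * ?r * normal_density 0 ?r x = exp (- (x\<^sup>2 / (2 * real (Suc n))))"
        by (simp add: normal_density_def real_sqrt_mult del: of_nat_Suc)
      then have *: "complex_of_real (sqrt (2 * pi) * ?r) * complex_of_real (normal_density 0 ?r x) = exp (- (x\<^sup>2 / (2 * real (Suc n))))"
        by (simp only: of_real_mult[symmetric])
      show "complex_of_real (sqrt (2 * pi) * ?r) * (normal_density 0 ?r x *\<^sub>R (fejer A x * iexp (s * x)))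
        = fejer A x * iexp (s * x) * exp (- (x\<^sup>2 / (2 * real (Suc n))))"
        unfolding scaleR_conv_of_real mult.assoc[symmetric] * by (simp add: mult_ac)
    qed
    finally show ?thesis .
  qed
  ultimately show ?thesis by (simp only:)
qed

text \<open>The Gaussian factors increase to 1 and the damped integrals converge by the previous
  lemma at \<open>s = 0\<close>, so monotone convergence yields integrability without any decay
  estimate.\<close>

lemma integrable_fejer:
  assumes A: "A > 0"
  shows "integrable lborel (fejer A)"
proof (rule integrable_monotone_convergence)
  let ?f = "\<lambda>n x. fejer A x * exp (- (x\<^sup>2 / (2 * real (Suc n))))"
  show int: "integrable lborel (?f n)" for n
  proof -
    have "integrable lborel (\<lambda>x. A\<^sup>2 * exp (- ((1 / sqrt (real (Suc n)))\<^sup>2 * x\<^sup>2 / 2)))"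
      using has_bochner_integral_gaussian[of "1 / sqrt (real (Suc n))"]
      by (intro integrable_mult_right) (simp add: has_bochner_integral_iff)
    then have "integrable lborel (\<lambda>x. A\<^sup>2 * exp (- (x\<^sup>2 / (2 * real (Suc n)))))"
      by (simp add: power_divide mult_ac del: of_nat_Suc)
    then show ?thesis
      by (rule Bochner_Integration.integrable_bound)
        (use fejer_nonneg fejer_upper_bound[OF A] in \<open>auto intro!: AE_I2 mult_right_mono simp: abs_mult\<close>)
  qed
  show "AE x in lborel. mono (\<lambda>n. ?f n x)"
    by (intro AE_I2 monoI mult_left_mono fejer_nonneg) (auto intro!: divide_left_mono)
  show "AE x in lborel. (\<lambda>n. ?f n x) \<longlonglongrightarrow> fejer A x"
  proof (intro AE_I2)
    fix x
    have "(\<lambda>n. x\<^sup>2 / (2 * real (Suc n))) \<longlonglongrightarrow> 0"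
      by real_asymp
    then have "(\<lambda>n. ?f n x) \<longlonglongrightarrow> fejer A x * exp (- 0)" by (intro tendsto_intros)
    then show "(\<lambda>n. ?f n x) \<longlonglongrightarrow> fejer A x" by simp
  qed
  have "(\<lambda>n. complex_of_real (\<integral>x. ?f n x \<partial>lborel)) \<longlonglongrightarrow> complex_of_real (2 * pi * tent A 0)"
  proof -
    have "complex_of_real (\<integral>x. ?f n x \<partial>lborel) = (CLINT x|lborel. fejer A x * iexp (0 * x) * exp (- (x\<^sup>2 / (2 * real (Suc n)))))" for n
      by (subst integral_complex_of_real[symmetric]) (simp del: of_nat_Suc integral_complex_of_real)
    then show ?thesis using fejer_gaussian[OF A, of 0] by (simp only:)
  qed
  then show "(\<lambda>n. \<integral>x. ?f n x \<partial>lborel) \<longlonglongrightarrow> 2 * pi * tent A 0"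
    by (simp only: tendsto_of_real_iff)
qed simp

lemma fejer_inversion:
  assumes A: "A > 0"
  shows "(CLINT x|lborel. fejer A x * iexp (s * x)) = 2 * pi * tent A s"
proof (rule LIMSEQ_unique)
  show "(\<lambda>n. CLINT x|lborel. fejer A x * iexp (s * x) * exp (- (x\<^sup>2 / (2 * real (Suc n)))))
     \<longlonglongrightarrow> (CLINT x|lborel. fejer A x * iexp (s * x))"
  proof (rule integral_dominated_convergence[OF _ _ integrable_fejer[OF A]])
    show "AE x in lborel. (\<lambda>n. fejer A x * iexp (s * x) * exp (- (x\<^sup>2 / (2 * real (Suc n))))) \<longlonglongrightarrow> fejer A x * iexp (s * x)"
    proof (intro AE_I2)
      fix x
      have "(\<lambda>n. x\<^sup>2 / (2 * real (Suc n))) \<longlonglongrightarrow> 0"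
        by real_asymp
      then have "(\<lambda>n. fejer A x * iexp (s * x) * exp (- (x\<^sup>2 / (2 * real (Suc n))))) \<longlonglongrightarrow> fejer A x * iexp (s * x) * complex_of_real (exp (- 0))"
        by (intro tendsto_intros tendsto_of_real)
      then show "(\<lambda>n. fejer A x * iexp (s * x) * exp (- (x\<^sup>2 / (2 * real (Suc n))))) \<longlonglongrightarrow> fejer A x * iexp (s * x)" by simp
    qed
  qed (auto simp: norm_mult fejer_nonneg intro!: AE_I2 mult_left_le)
qed (rule fejer_gaussian[OF A])

section \<open>Local limits of exponential integrals\<close>

context centered_distribution
begin

text \<open>Weighted by the kernel and normalised, the laws become probability measures whose
  characteristic functions tend to \<open>tent A t / A\<close>, which by inversion belongs to the
  normalised kernel itself. Levy's theorem gives weak convergence, and a test function that divides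
  the kernel out recovers the original integrals.\<close>

lemma nonlattice_window_limit:
  assumes \<theta>: "\<theta> > 0" and K: "K > 0"
    and N: "\<And>n. real_distribution (N n)" "\<And>n t. char (N n) t = char M t ^ n"
    and nl: "\<And>t. t \<noteq> 0 \<Longrightarrow> cmod (char M t) < 1"
  shows "(\<lambda>n. sqrt (real n) * (\<integral>x. indicator {0..<K} x * exp (- \<theta> * x) \<partial>N n))
     \<longlonglongrightarrow> (1 - exp (- \<theta> * K)) / (\<theta> * \<sigma> * sqrt (2 * pi))"
proof -
  \<comment> \<open>With this A every x in the window satisfies \<open>|A x| \<le> 1\<close>, the
    range on which the kernel is at least \<open>A^2 / 2\<close>.\<close>
  define A where "A = 1 / K"
  have A: "A > 0" using K by (simp add: A_def)
  have fpos: "fejer A x \<ge> A\<^sup>2 / 2" if "x \<in> {0..<K}" for x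
    using that K by (intro fejer_lower_bound A) (auto simp: A_def)
  have int: "integrable (N n) (fejer A)" for n
  proof -
    interpret N: real_distribution "N n" by (rule N)
    show ?thesis
      using fejer_upper_bound[OF A] fejer_nonneg
      by (intro N.integrable_const_bound[where B = "A\<^sup>2"]) auto
  qed
  define J where "J n = (\<integral>x. fejer A x \<partial>N n)" for n
  have J0: "J n \<ge> 0" for n unfolding J_def by (intro integral_nonneg_AE) (auto simp: fejer_nonneg)
  have lim: "(\<lambda>n. complex_of_real (sqrt (real n)) * (CLINT x|N n. fejer A x * iexp (s * x)))
      \<longlonglongrightarrow> tent A s * complex_of_real (sqrt (2 * pi) / \<sigma>)" for s
  proof -
    have "(\<lambda>n. complex_of_real (sqrt (real n)) * (CLINT t|lborel. tent A (t - s) * char M t ^ n))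
      \<longlonglongrightarrow> complex_of_real (tent A (0 - s)) * complex_of_real (sqrt (2 * pi) / \<sigma>)"
    proof (rule char_power_laplace[where B = A and a = "A + \<bar>s\<bar>"])
      show "isCont (\<lambda>t. complex_of_real (tent A (t - s))) 0"
        by (intro continuous_intros isCont_o2[OF _ isCont_tent])
      show "complex_of_real (tent A (t - s)) = 0" if "A + \<bar>s\<bar> < \<bar>t\<bar>" for t
        using that by (simp add: tent_eq_0)
    qed (use A tent_bounds nl in auto)
    moreover have "(CLINT t|lborel. tent A (t - s) * char M t ^ n) = (CLINT x|N n. fejer A x * iexp (s * x))" for n
      using real_distribution.fejer_parseval[OF N(1) A, of n s] by (simp only: N(2))
    ultimately show ?thesis by simp
  qed
  have limJ: "(\<lambda>n. sqrt (real n) * J n) \<longlonglongrightarrow> A * (sqrt (2 * pi) / \<sigma>)"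
  proof -
    have "(\<lambda>n. complex_of_real (sqrt (real n) * J n)) \<longlonglongrightarrow> complex_of_real (A * (sqrt (2 * pi) / \<sigma>))"
      using lim[of 0] A by (simp add: J_def tent_def)
    then show ?thesis by (simp only: tendsto_of_real_iff)
  qed
  have "A * (sqrt (2 * pi) / \<sigma>) > 0" using A \<sigma>_pos by simp
  then have "\<forall>\<^sub>F n in sequentially. sqrt (real n) * J n > 0"
    using limJ by (intro order_tendstoD(1))
  then obtain n0 where n0: "\<And>n. n \<ge> n0 \<Longrightarrow> sqrt (real n) * J n > 0"
    by (auto simp: eventually_sequentially)
  have Jpos: "J n > 0" if "n \<ge> n0" for n
    using n0[OF that] J0[of n] by (cases "J n = 0") auto
  \<comment> \<open>From n0 on the total mass J is positive and can be divided by; the shift by n0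
    is undone at the end.\<close>
  define \<nu> where "\<nu> n = density (N (n + n0)) (\<lambda>x. fejer A x / J (n + n0))" for n
  define \<nu>' where "\<nu>' = density lborel (\<lambda>x. fejer A x / (2 * pi * A))"
  have int_nu: "integral\<^sup>L (\<nu> n) f = (\<integral>x. (fejer A x / J (n + n0)) *\<^sub>R f x \<partial>N (n + n0))"
    if "f \<in> borel_measurable borel" for n and f :: "real \<Rightarrow> 'b :: {banach, second_countable_topology}"
  proof -
    interpret N: real_distribution "N (n + n0)" by (rule N)
    show ?thesis unfolding \<nu>_def using that Jpos[of "n + n0"]
      by (intro integral_density) (auto simp: fejer_nonneg)
  qed
  have int_nu': "integral\<^sup>L \<nu>' f = (\<integral>x. (fejer A x / (2 * pi * A)) *\<^sub>R f x \<partial>lborel)"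
    if "f \<in> borel_measurable borel" for f :: "real \<Rightarrow> 'b :: {banach, second_countable_topology}"
    unfolding \<nu>'_def using that A by (intro integral_density) (auto simp: fejer_nonneg)
  have rd: "real_distribution (\<nu> n)" for n
  proof -
    interpret N: real_distribution "N (n + n0)" by (rule N)
    have "emeasure (\<nu> n) (space (\<nu> n)) = (\<integral>\<^sup>+x. ennreal (fejer A x / J (n + n0)) \<partial>N (n + n0))"
      unfolding \<nu>_def by (simp add: emeasure_density)
    also have "\<dots> = ennreal (\<integral>x. fejer A x / J (n + n0) \<partial>N (n + n0))"
      using int Jpos[of "n + n0"] by (intro nn_integral_eq_integral) (auto simp: fejer_nonneg)
    also have "(\<integral>x. fejer A x / J (n + n0) \<partial>N (n + n0)) = 1"
      using Jpos[of "n + n0"] by (simp add: J_def[symmetric])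
    finally have "prob_space (\<nu> n)" by (intro prob_spaceI) simp
    then show ?thesis
      by (simp add: real_distribution_def real_distribution_axioms_def \<nu>_def)
  qed
  have fejer_int: "(\<integral>x. fejer A x \<partial>lborel) = 2 * pi * A"
  proof -
    have "complex_of_real (\<integral>x. fejer A x \<partial>lborel) = complex_of_real (2 * pi * A)"
      using fejer_inversion[OF A, of 0] A by (simp add: tent_def)
    then show ?thesis by (simp only: of_real_eq_iff)
  qed
  have rd': "real_distribution \<nu>'"
  proof -
    have "emeasure \<nu>' (space \<nu>') = (\<integral>\<^sup>+x. ennreal (fejer A x / (2 * pi * A)) \<partial>lborel)"
      unfolding \<nu>'_def by (simp add: emeasure_density)
    also have "\<dots> = ennreal (\<integral>x. fejer A x / (2 * pi * A) \<partial>lborel)"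
      using integrable_fejer[OF A] A by (intro nn_integral_eq_integral) (auto simp: fejer_nonneg)
    also have "(\<integral>x. fejer A x / (2 * pi * A) \<partial>lborel) = 1"
      using A by (simp add: fejer_int)
    finally have "prob_space \<nu>'" by (intro prob_spaceI) simp
    then show ?thesis
      by (simp add: real_distribution_def real_distribution_axioms_def \<nu>'_def)
  qed
  have weak: "weak_conv_m \<nu> \<nu>'"
  proof (rule levy_continuity[OF rd rd'])
    fix t
    have "char \<nu>' t = complex_of_real (1 / (2 * pi * A)) * (CLINT x|lborel. fejer A x * iexp (t * x))"
      unfolding char_def by (subst int_nu', simp, subst integral_mult_right_zero[symmetric])
        (simp add: scaleR_conv_of_real)
    then have c': "char \<nu>' t = tent A t / A"
      unfolding fejer_inversion[OF A] using A by simp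
    have "char (\<nu> n) t = (complex_of_real (sqrt (n + n0)) * (CLINT x|N (n + n0). fejer A x * iexp (t * x))) / complex_of_real (sqrt (n + n0) * J (n + n0))" for n
    proof -
      have "char (\<nu> n) t = complex_of_real (1 / J (n + n0)) * (CLINT x|N (n + n0). fejer A x * iexp (t * x))"
        unfolding char_def by (subst int_nu, simp, subst integral_mult_right_zero[symmetric])
          (simp add: scaleR_conv_of_real)
      moreover have "sqrt (n + n0) \<noteq> 0" using n0[of "n + n0"] by auto
      ultimately show ?thesis by (simp add: field_simps)
    qed
    moreover have "(\<lambda>n. (complex_of_real (sqrt n) * (CLINT x|N n. fejer A x * iexp (t * x))) / complex_of_real (sqrt n * J n))
        \<longlonglongrightarrow> tent A t * complex_of_real (sqrt (2 * pi) / \<sigma>) / complex_of_real (A * (sqrt (2 * pi) / \<sigma>))"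
      using A \<sigma>_pos by (intro tendsto_divide tendsto_of_real lim limJ) auto
    from LIMSEQ_ignore_initial_segment[OF this, of n0]
    have "(\<lambda>n. (complex_of_real (sqrt (n + n0)) * (CLINT x|N (n + n0). fejer A x * iexp (t * x))) / complex_of_real (sqrt (n + n0) * J (n + n0)))
        \<longlonglongrightarrow> tent A t * complex_of_real (sqrt (2 * pi) / \<sigma>) / complex_of_real (A * (sqrt (2 * pi) / \<sigma>))" .
    moreover have "tent A t * complex_of_real (sqrt (2 * pi) / \<sigma>) / complex_of_real (A * (sqrt (2 * pi) / \<sigma>)) = char \<nu>' t"
      unfolding c' using A \<sigma>_pos by simp
    ultimately show "(\<lambda>n. char (\<nu> n) t) \<longlonglongrightarrow> char \<nu>' t" by simp
  qed
  \<comment> \<open>Bounded because the kernel is bounded below on the window, and continuous except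
    at 0 and K, two points that carry no mass in the limit law.\<close>
  define f where "f x = indicator {0..<K} x * exp (- \<theta> * x) / fejer A x" for x
  have [measurable]: "f \<in> borel_measurable borel" unfolding f_def by measurable
  have fbd: "norm (f x) \<le> 2 / A\<^sup>2" for x
  proof (cases "x \<in> {0..<K}")
    case True
    then have "exp (- \<theta> * x) / fejer A x \<le> 1 / (A\<^sup>2 / 2)"
      using fpos[OF True] \<theta> A by (intro frac_le) auto
    then show ?thesis using True fejer_nonneg[of A x] by (simp add: f_def)
  qed (auto simp: f_def)
  have cont: "isCont f x" if "x \<notin> {0, K}" for x
  proof -
    consider "x < 0" | "x > K" | "x \<in> {0<..<K}" using \<open>x \<notin> {0, K}\<close> by fastforce
    then show ?thesis
    proof cases
      case 1
      have "\<forall>\<^sub>F y in nhds x. f y = 0"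
        using eventually_nhds_in_open[of "{..<0}" x] 1 by (auto elim!: eventually_mono simp: f_def)
      then show ?thesis by (subst isCont_cong) auto
    next
      case 2
      have "\<forall>\<^sub>F y in nhds x. f y = 0"
        using eventually_nhds_in_open[of "{K<..}" x] 2 K by (auto elim!: eventually_mono simp: f_def)
      then show ?thesis by (subst isCont_cong) auto
    next
      case 3
      \<comment> \<open>Off 0 the kernel is given by one formula, whose value at x is nonzero by
        \<open>fpos\<close>.\<close>
      let ?g = "\<lambda>y. exp (- \<theta> * y) / (2 * (1 - cos (A * y)) / y\<^sup>2)"
      have "\<forall>\<^sub>F y in nhds x. f y = ?g y"
        using eventually_nhds_in_open[of "{0<..<K}" x] 3 by (auto elim!: eventually_mono simp: f_def fejer_def)
      moreover have "isCont ?g x"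
        using 3 fpos[of x] A by (intro continuous_intros) (auto simp: fejer_def)
      ultimately show ?thesis by (subst isCont_cong) auto
    qed
  qed
  have "emeasure \<nu>' {x. \<not> isCont f x} = 0"
  proof -
    interpret nu: real_distribution \<nu>' by (rule rd')
    have "emeasure \<nu>' {x. \<not> isCont f x} \<le> emeasure \<nu>' {0, K}"
      using cont by (intro emeasure_mono) auto
    also have "\<dots> = (\<integral>\<^sup>+x. ennreal (fejer A x / (2 * pi * A)) * indicator {0, K} x \<partial>lborel)"
      unfolding \<nu>'_def by (rule emeasure_density) auto
    also have "\<dots> = (\<integral>\<^sup>+(x::real). 0 \<partial>lborel)"
    proof (rule nn_integral_cong_AE)
      have "AE x in lborel. x \<notin> {0, K}"
        by (intro AE_not_in finite_imp_null_set_lborel) auto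
      then show "AE x in lborel. ennreal (fejer A x / (2 * pi * A)) * indicator {0, K} x = 0"
        by eventually_elim simp
    qed
    finally show ?thesis by simp
  qed
  from weak_conv_imp_bdd_ae_continuous_conv[OF rd rd' weak this fbd]
  have conv: "(\<lambda>n. integral\<^sup>L (\<nu> n) f) \<longlonglongrightarrow> integral\<^sup>L \<nu>' f" by simp
  have ff: "fejer A x * f x = indicator {0..<K} x * exp (- \<theta> * x)" for x
    using fpos[of x] A by (cases "x \<in> {0..<K}") (auto simp: f_def)
  have "integral\<^sup>L \<nu>' f = (1 - exp (- \<theta> * K)) / (\<theta> * 2 * pi * A)"
  proof -
    have "integral\<^sup>L \<nu>' f = (\<integral>x. indicator {0..<K} x * exp (- \<theta> * x) / (2 * pi * A) \<partial>lborel)"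
      by (subst int_nu') (simp_all add: ff)
    also have "\<dots> = (\<integral>x. indicator {0..<K} x * exp (- \<theta> * x) \<partial>lborel) / (2 * pi * A)" by simp
    also have "(\<integral>x. indicator {0..<K} x * exp (- \<theta> * x) \<partial>lborel) = (\<integral>x. exp (- \<theta> * x) * indicator {0..K} x \<partial>lborel)"
    proof (rule integral_cong_AE)
      show "AE x in lborel. indicator {0..<K} x * exp (- \<theta> * x) = exp (- \<theta> * x) * indicator {0..K} x"
        using AE_lborel_singleton[of K] by eventually_elim (auto simp: indicator_def)
    qed auto
    also have "\<dots> = - exp (- \<theta> * K) / \<theta> - - exp (- \<theta> * 0) / \<theta>"
      using K \<theta> by (intro integral_FTC_Icc_real) (auto intro!: derivative_eq_intros continuous_intros)
    finally show ?thesis using \<theta> by (simp add: field_simps)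
  qed
  with conv have conv: "(\<lambda>n. integral\<^sup>L (\<nu> n) f) \<longlonglongrightarrow> (1 - exp (- \<theta> * K)) / (\<theta> * 2 * pi * A)" by simp
  \<comment> \<open>Restoring the mass J cancels A: \<open>A sqrt (2 pi) / \<sigma>\<close> over
    \<open>2 pi A\<close> is \<open>1 / (\<sigma> sqrt (2 pi))\<close>.\<close>
  have "(\<lambda>n. (sqrt (real (n + n0)) * J (n + n0)) * integral\<^sup>L (\<nu> n) f)
      \<longlonglongrightarrow> A * (sqrt (2 * pi) / \<sigma>) * ((1 - exp (- \<theta> * K)) / (\<theta> * 2 * pi * A))"
    by (intro tendsto_mult LIMSEQ_ignore_initial_segment[OF limJ] conv)
  moreover have "(sqrt (real (n + n0)) * J (n + n0)) * integral\<^sup>L (\<nu> n) f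
     = sqrt (real (n + n0)) * (\<integral>x. indicator {0..<K} x * exp (- \<theta> * x) \<partial>N (n + n0))" for n
  proof -
    have "integral\<^sup>L (\<nu> n) f = (\<integral>x. indicator {0..<K} x * exp (- \<theta> * x) / J (n + n0) \<partial>N (n + n0))"
      by (subst int_nu) (simp_all add: ff)
    then show ?thesis using Jpos[of "n + n0"] by simp
  qed
  moreover have "A * (sqrt (2 * pi) / \<sigma>) * ((1 - exp (- \<theta> * K)) / (\<theta> * 2 * pi * A))
      = (1 - exp (- \<theta> * K)) / (\<theta> * \<sigma> * sqrt (2 * pi))"
  proof -
    have "sqrt (2 * pi) * sqrt (2 * pi) = 2 * pi" by simp
    then have "A * (sqrt (2 * pi) / \<sigma>) * (E / (\<theta> * 2 * pi * A)) = E / (\<theta> * \<sigma> * sqrt (2 * pi))" for E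
      using A \<sigma>_pos \<theta> by (simp add: field_simps)
    then show ?thesis .
  qed
  ultimately have "(\<lambda>n. sqrt (real (n + n0)) * (\<integral>x. indicator {0..<K} x * exp (- \<theta> * x) \<partial>N (n + n0)))
      \<longlonglongrightarrow> (1 - exp (- \<theta> * K)) / (\<theta> * \<sigma> * sqrt (2 * pi))"
    by (simp only:)
  then show ?thesis by (rule LIMSEQ_offset)
qed

theorem nonlattice_exp_integral_limit:
  assumes \<theta>: "\<theta> > 0"
    and N: "\<And>n. real_distribution (N n)" "\<And>n t. char (N n) t = char M t ^ n"
    and nl: "\<And>t. t \<noteq> 0 \<Longrightarrow> cmod (char M t) < 1"
  shows "(\<lambda>n. sqrt (real n) * (\<integral>x. indicator {0..} x * exp (- \<theta> * x) \<partial>N n)) \<longlonglongrightarrow> 1 / (\<theta> * \<sigma> * sqrt (2 * pi))"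
proof (rule exp_integral_limit_of_windows[OF \<theta> zero_less_one N])
  show "(\<lambda>n. sqrt (real n) * (\<integral>x. indicator {0..<1 * real m} x * exp (- \<theta> * x) \<partial>N n))
     \<longlonglongrightarrow> (1 - exp (- \<theta> * (1 * real m))) / (\<theta> * \<sigma> * sqrt (2 * pi))" if "m > 0" for m
    using that by (intro nonlattice_window_limit[OF \<theta> _ N nl]) auto
  have "(\<lambda>m. exp (- \<theta> * (1 * real m))) \<longlonglongrightarrow> 0"
    using \<theta> by real_asymp
  then have "(\<lambda>m. (1 - exp (- \<theta> * (1 * real m))) / (\<theta> * \<sigma> * sqrt (2 * pi))) \<longlonglongrightarrow> (1 - 0) / (\<theta> * \<sigma> * sqrt (2 * pi))"
    using \<theta> \<sigma>_pos by (intro tendsto_intros) auto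
  then show "(\<lambda>m. (1 - exp (- \<theta> * (1 * real m))) / (\<theta> * \<sigma> * sqrt (2 * pi))) \<longlonglongrightarrow> 1 / (\<theta> * \<sigma> * sqrt (2 * pi))"
    by simp
qed

end

section \<open>Point masses and exponential integrals of lattice laws\<close>

text \<open>Orthogonality of characters: integrated over one period,
  \<open>exp (i t h (j - k))\<close> vanishes unless \<open>j = k\<close>. The frequency range is
  compact by itself, so no smoothing kernel enters.\<close>

lemma (in real_distribution) lattice_point_inversion:
  fixes h :: real and k :: int
  assumes h: "h > 0" and lat: "AE x in M. x / h \<in> \<int>"
  shows "measure M {h * k} = h / (2 * pi) * Re (CLINT t|lborel. indicator {-pi/h..pi/h} t * iexp (- (t * (h * k))) * char M t)"
proof -
  let ?g = "\<lambda>t. indicator {-pi/h..pi/h} t * iexp (- (t * (h * k)))"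
  have int: "integrable lborel ?g"
  proof (rule integrableI_bounded_set[where A = "{-pi/h..pi/h}" and B = 1])
    show "emeasure lborel {-pi/h..pi/h} < \<infinity>" by (simp add: emeasure_lborel_Icc_eq)
  qed (auto simp: indicator_def norm_mult)
  have eq: "(CLINT t|lborel. ?g t * iexp (t * x)) = complex_of_real (2 * pi / h * indicator {h * k} x)"
    if x: "x / h \<in> \<int>" for x
  proof -
    obtain j :: int where "x / h = of_int j" using x by (elim Ints_cases)
    then have j: "x = h * j" using h by (simp add: field_simps)
    have "(CLINT t|lborel. ?g t * iexp (t * x)) = (CLINT t|lborel. indicator {-pi/h..pi/h} t *\<^sub>R iexp (t * (h * (j - k))))"
      by (intro Bochner_Integration.integral_cong refl)
        (auto simp: indicator_def j exp_add[symmetric] algebra_simps)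
    also have "\<dots> = complex_of_real (2 * pi / h * indicator {h * k} x)"
    proof (cases "j = k")
      case True
      then show ?thesis using h by (simp add: j scaleR_conv_of_real)
    next
      case False
      define c where "c = h * real_of_int (j - k)"
      have c: "c \<noteq> 0" using False h by (simp add: c_def)
      have "(CLINT t|lborel. indicator {-pi/h..pi/h} t *\<^sub>R iexp (t * c)) = iexp (pi/h * c) / (\<i> * c) - iexp (-pi/h * c) / (\<i> * c)"
      proof (rule integral_FTC_Icc)
        fix t
        have "((iexp \<circ> (\<lambda>t. t * c)) has_vector_derivative c *\<^sub>R (\<i> * iexp (t * c))) (at t within {-pi/h..pi/h})"
          by (intro vector_diff_chain_within has_vector_derivative_iexp)
             (auto intro!: derivative_eq_intros simp: has_real_derivative_iff_has_vector_derivative[symmetric])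
        from has_vector_derivative_divide[OF this, of "\<i> * c"]
        show "((\<lambda>t. iexp (t * c) / (\<i> * c)) has_vector_derivative iexp (t * c)) (at t within {-pi/h..pi/h})"
          using c by (simp add: comp_def scaleR_conv_of_real)
      qed (use h in \<open>auto intro!: continuous_intros\<close>)
      \<comment> \<open>The phases at the two endpoints differ by \<open>j - k\<close> full turns,
        so the character integrates to 0.\<close>
      also have "iexp (pi/h * c) = iexp (-pi/h * c)"
      proof -
        have "pi / h * c = -pi/h * c + 2 * pi * real_of_int (j - k)"
          using h by (simp add: c_def field_simps)
        then have "iexp (pi/h * c) = iexp (-pi/h * c) * exp (\<i> * of_real (2 * pi * real_of_int (j - k)))"
          by (simp only: of_real_add distrib_left exp_add)
        also have "exp (\<i> * of_real (2 * pi * real_of_int (j - k))) = 1"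
          using exp_integer_2pi[of "of_int (j - k)"] by (simp add: mult_ac)
        finally show ?thesis by simp
      qed
      finally show ?thesis using False h by (simp add: j c_def)
    qed
    finally show ?thesis .
  qed
  have "(CLINT t|lborel. ?g t * char M t) = (CLINT x|M. (CLINT t|lborel. ?g t * iexp (t * x)))"
    by (rule fourier_parseval[OF int, symmetric])
  also have "\<dots> = (CLINT x|M. complex_of_real (2 * pi / h * indicator {h * k} x))"
  proof (rule integral_cong_AE)
    show "AE x in M. (CLINT t|lborel. ?g t * iexp (t * x)) = complex_of_real (2 * pi / h * indicator {h * k} x)"
      using lat by eventually_elim (rule eq)
    have [measurable]: "?g \<in> borel_measurable lborel" using int by simp
    show "(\<lambda>x. CLINT t|lborel. ?g t * iexp (t * x)) \<in> borel_measurable M"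
      by measurable
  qed simp
  also have "\<dots> = complex_of_real (2 * pi / h * measure M {h * k})"
    by (subst integral_complex_of_real) simp
  finally show ?thesis using h by simp
qed

context centered_distribution
begin

text \<open>Inversion uses only \<open>|t| \<le> pi / h\<close>, well inside the range where the
  modulus stays below 1. The limit is the same for every k because the phase equals 1 at
  \<open>t = 0\<close>.\<close>

lemma lattice_point_limit:
  assumes h: "h > 0"
    and N: "\<And>n. real_distribution (N n)" "\<And>n t. char (N n) t = char M t ^ n"
    and lat: "\<And>n. AE x in N n. x / h \<in> \<int>"
    and sp: "\<And>t. 0 < \<bar>t\<bar> \<Longrightarrow> \<bar>t\<bar> < 2 * pi / h \<Longrightarrow> cmod (char M t) < 1"
  shows "(\<lambda>n. sqrt (real n) * measure (N n) {h * of_int k}) \<longlonglongrightarrow> h / (\<sigma> * sqrt (2 * pi))"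
proof -
  let ?g = "\<lambda>t. indicator {-pi/h..pi/h} t * iexp (- (t * (h * k)))"
  have ph: "0 < pi / h" using h by simp
  have "(\<lambda>n. complex_of_real (sqrt (real n)) * (CLINT t|lborel. ?g t * char M t ^ n))
     \<longlonglongrightarrow> ?g 0 * complex_of_real (sqrt (2 * pi) / \<sigma>)"
  proof (rule char_power_laplace[where B = 1 and a = "pi / h"])
    have "\<forall>\<^sub>F t in nhds 0. ?g t = iexp (- (t * (h * k)))"
      using eventually_nhds_in_open[of "{-pi/h<..<pi/h}" 0] ph by (auto elim!: eventually_mono)
    moreover have "isCont (\<lambda>t. iexp (- (t * (h * k)))) 0" by (intro continuous_intros)
    ultimately show "isCont ?g 0" by (subst isCont_cong)
    show "cmod (char M t) < 1" if "0 < \<bar>t\<bar>" "\<bar>t\<bar> \<le> pi / h" for t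
    proof (rule sp)
      have "pi / h < 2 * pi / h" using h by (simp add: field_simps)
      then show "\<bar>t\<bar> < 2 * pi / h" using that by linarith
    qed (rule that)
  qed (auto simp: indicator_def norm_mult)
  from tendsto_mult[OF tendsto_const tendsto_Re[OF this], of "h / (2 * pi)"]
  have "(\<lambda>n. h / (2 * pi) * Re (complex_of_real (sqrt (real n)) * (CLINT t|lborel. ?g t * char M t ^ n)))
     \<longlonglongrightarrow> h / (2 * pi) * Re (?g 0 * complex_of_real (sqrt (2 * pi) / \<sigma>))" .
  moreover have "h / (2 * pi) * Re (complex_of_real (sqrt (real n)) * (CLINT t|lborel. ?g t * char M t ^ n))
      = sqrt (real n) * measure (N n) {h * of_int k}" for n
    unfolding real_distribution.lattice_point_inversion[OF N(1) h lat] N(2) by simp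
  moreover have "h / (2 * pi) * Re (?g 0 * complex_of_real (sqrt (2 * pi) / \<sigma>)) = h / (\<sigma> * sqrt (2 * pi))"
  proof -
    have "h / (r * r) * (r / \<sigma>) = h / (\<sigma> * r)" if "r > 0" for r
      using that \<sigma>_pos by (simp add: field_simps)
    from this[of "sqrt (2 * pi)"] have "h / (2 * pi) * (sqrt (2 * pi) / \<sigma>) = h / (\<sigma> * sqrt (2 * pi))"
      by (simp only: real_sqrt_mult_self abs_of_pos pi_gt_zero zero_less_mult_iff zero_less_numeral real_sqrt_gt_0_iff simp_thms)
    moreover have "?g 0 = 1" using ph by simp
    ultimately show ?thesis by (simp only: mult_1 Re_complex_of_real)
  qed
  ultimately show ?thesis by simp
qed

text \<open>The half-open window \<open>[0, h m)\<close> contains exactly the lattice points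
  \<open>h k\<close> with \<open>k < m\<close>, so the integral is a finite sum of point masses, and
  its limits are partial sums of a geometric series.\<close>

theorem lattice_exp_integral_limit:
  assumes \<theta>: "\<theta> > 0" and h: "h > 0"
    and N: "\<And>n. real_distribution (N n)" "\<And>n t. char (N n) t = char M t ^ n"
    and lat: "\<And>n. AE x in N n. x / h \<in> \<int>"
    and sp: "\<And>t. 0 < \<bar>t\<bar> \<Longrightarrow> \<bar>t\<bar> < 2 * pi / h \<Longrightarrow> cmod (char M t) < 1"
  shows "(\<lambda>n. sqrt (real n) * (\<integral>x. indicator {0..} x * exp (- \<theta> * x) \<partial>N n))
    \<longlonglongrightarrow> h / (1 - exp (- \<theta> * h)) / (\<sigma> * sqrt (2 * pi))"
proof (rule exp_integral_limit_of_windows[OF \<theta> h N])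
  let ?q = "exp (- \<theta> * h)"
  let ?L = "h / (\<sigma> * sqrt (2 * pi))"
  have q: "0 < ?q" "?q < 1" using \<theta> h by auto
  show "(\<lambda>n. sqrt (real n) * (\<integral>x. indicator {0..<h * real m} x * exp (- \<theta> * x) \<partial>N n)) \<longlonglongrightarrow> (\<Sum>k<m. ?q ^ k * ?L)"
    if "m > 0" for m
  proof -
    have "sqrt (real n) * (\<integral>x. indicator {0..<h * real m} x * exp (- \<theta> * x) \<partial>N n)
        = (\<Sum>k<m. ?q ^ k * (sqrt (real n) * measure (N n) {h * of_int (int k)}))" for n
    proof -
      interpret N: real_distribution "N n" by (rule N)
      have "(\<integral>x. indicator {0..<h * real m} x * exp (- \<theta> * x) \<partial>N n) = (\<integral>x. (\<Sum>k<m. ?q ^ k * indicator {h * of_int (int k)} x) \<partial>N n)"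
      proof (rule integral_cong_AE)
        show "AE x in N n. indicator {0..<h * real m} x * exp (- \<theta> * x) = (\<Sum>k<m. ?q ^ k * indicator {h * of_int (int k)} x)"
          using lat[of n]
        proof eventually_elim
          fix x assume "x / h \<in> \<int>"
          then obtain j :: int where "x / h = of_int j" by (elim Ints_cases)
          then have j: "x = h * j" using h by (simp add: field_simps)
          have "(\<Sum>k<m. ?q ^ k * indicator {h * of_int (int k)} x) = (\<Sum>k<m. if int k = j then ?q ^ k else 0)"
            using h by (intro sum.cong refl) (auto simp: j)
          also have "\<dots> = indicator {0..<h * real m} x * exp (- \<theta> * x)"
          proof (cases "0 \<le> j \<and> j < int m")
            case True
            then obtain i where i: "j = int i" "i < m" using zero_le_imp_eq_int[of j] by auto
            have "(\<Sum>k<m. if int k = j then ?q ^ k else 0) = ?q ^ i"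
              using i by (simp add: sum.delta)
            also have "\<dots> = exp (- \<theta> * x)"
              by (simp add: j i exp_of_nat_mult[symmetric] mult_ac)
            finally show ?thesis using i h by (simp add: j)
          next
            case False
            then have "\<not> (x \<in> {0..<h * real m})"
              using h by (auto simp: j zero_le_mult_iff)
            moreover have "(\<Sum>k<m. if int k = j then ?q ^ k else 0) = 0"
              using False by (intro sum.neutral) auto
            ultimately show ?thesis by simp
          qed
          finally show "indicator {0..<h * real m} x * exp (- \<theta> * x) = (\<Sum>k<m. ?q ^ k * indicator {h * of_int (int k)} x)" ..
        qed
      qed measurable
      also have "\<dots> = (\<Sum>k<m. ?q ^ k * measure (N n) {h * of_int (int k)})"
        by (subst Bochner_Integration.integral_sum)
          (auto intro!: integrable_mult_right N.integrable_const_bound[where B = 1])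
      finally show ?thesis by (simp add: sum_distrib_left mult_ac)
    qed
    moreover have "(\<lambda>n. \<Sum>k<m. ?q ^ k * (sqrt (real n) * measure (N n) {h * of_int (int k)})) \<longlonglongrightarrow> (\<Sum>k<m. ?q ^ k * ?L)"
      by (intro tendsto_sum tendsto_mult tendsto_const lattice_point_limit[OF h N lat sp])
    ultimately show ?thesis by simp
  qed
  have "(\<lambda>k. ?q ^ k) sums (1 / (1 - ?q))"
    using q by (intro geometric_sums) auto
  from sums_mult2[OF this, of ?L]
  show "(\<lambda>m. \<Sum>k<m. ?q ^ k * ?L) \<longlonglongrightarrow> h / (1 - ?q) / (\<sigma> * sqrt (2 * pi))"
    by (simp add: sums_def)
qed

end

section \<open>Derivatives of the cumulant generating function\<close>

text \<open>The equality case of the triangle inequality: if c is the argument of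
  \<open>char M t\<close>, the nonnegative variable \<open>1 - cos (t X - c)\<close> has mean 0,
  hence \<open>t X - c\<close> is almost surely a multiple of \<open>2 pi\<close>.\<close>

lemma (in real_distribution) char_eq_1_imp_lattice:
  assumes t: "t \<noteq> 0" and c1: "cmod (char M t) = 1"
  shows "\<exists>x0. AE x in M. (x - x0) / (2 * pi / \<bar>t\<bar>) \<in> \<int>"
proof -
  obtain c where c: "char M t = iexp c"
  proof -
    have "char M t = cis (Arg (char M t))"
      using c1 by (metis norm_zero rcis_cmod_Arg rcis_def mult_1 of_real_1 zero_neq_one)
    then show ?thesis using that[of "Arg (char M t)"] by (simp add: cis_conv_exp)
  qed
  have int: "integrable M (\<lambda>x. cos (t * x - c))"
    by (rule integrable_const_bound[where B = 1]) auto
  have "1 = Re (iexp (- c) * char M t)"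
    by (simp add: c exp_add[symmetric])
  also have "iexp (- c) * char M t = (CLINT x|M. iexp (t * x - c))"
    unfolding char_def by (subst integral_mult_right_zero[symmetric])
      (simp add: exp_add[symmetric] algebra_simps)
  also have "Re \<dots> = (\<integral>x. cos (t * x - c) \<partial>M)"
  proof -
    have "integrable M (\<lambda>x. iexp (t * x - c))" by (rule integrable_const_bound[where B = 1]) (auto simp del: of_real_diff of_real_mult)
    then show ?thesis by (subst integral_Re[symmetric]) (auto simp: Re_exp)
  qed
  finally have "(\<integral>x. 1 - cos (t * x - c) \<partial>M) = 0"
    using int by (subst Bochner_Integration.integral_diff) (auto simp: prob_space simp del: space_eq_univ)
  moreover have "integrable M (\<lambda>x. 1 - cos (t * x - c))" using int by auto
  ultimately have "AE x in M. 1 - cos (t * x - c) = 0"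
    by (subst integral_nonneg_eq_0_iff_AE[symmetric]) auto
  then have "AE x in M. (x - c / t) / (2 * pi / \<bar>t\<bar>) \<in> \<int>"
  proof eventually_elim
    fix x assume "1 - cos (t * x - c) = 0"
    then obtain j :: int where j: "t * x - c = real_of_int j * 2 * pi"
      by (auto simp: cos_one_2pi_int)
    have "(x - c / t) / (2 * pi / \<bar>t\<bar>) = (t * x - c) / (2 * pi) * (\<bar>t\<bar> / t)"
      using t by (simp add: field_simps)
    also have "\<dots> = real_of_int j * sgn t"
      using t by (cases "t > 0") (simp_all add: j sgn_real_def)
    finally show "(x - c / t) / (2 * pi / \<bar>t\<bar>) \<in> \<int>"
      by (simp add: sgn_real_def)
  qed
  then show ?thesis by blast
qed

section \<open>Differentiation of exponential moments under the integral sign\<close>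

text \<open>Controls difference quotients of \<open>exp (\<eta> * x)\<close> in \<eta>. For
  \<open>z \<ge> 0\<close> it is \<open>1 - z \<le> exp (- z)\<close> multiplied by
  \<open>exp z\<close>.\<close>

lemma abs_exp_minus_one_le: "\<bar>exp z - 1\<bar> \<le> \<bar>z\<bar> * exp \<bar>z\<bar>" for z :: real
proof (cases "z \<ge> 0")
  case True
  have "exp z * (1 - z) \<le> exp z * exp (- z)"
    using exp_ge_add_one_self[of "- z"] by (intro mult_left_mono) auto
  then show ?thesis using True by (simp add: algebra_simps exp_minus_inverse)
next
  case False
  have "1 - E \<le> \<bar>z\<bar> * 1" if "1 + z \<le> E" for E using that False by simp
  from this[OF exp_ge_add_one_self] have "1 - exp z \<le> \<bar>z\<bar> * 1" .
  also have "\<dots> \<le> \<bar>z\<bar> * exp \<bar>z\<bar>" by (intro mult_left_mono) auto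
  finally show ?thesis using False by simp
qed

text \<open>From \<open>y \<le> exp y\<close> at \<open>y = d |x| / (k + 1)\<close>, raised to the
  power k; dividing by \<open>k + 1\<close> instead of k covers \<open>k = 0\<close>.\<close>

lemma abs_power_le_exp:
  fixes x d :: real
  assumes d: "d > 0"
  shows "\<bar>x\<bar> ^ k \<le> (real (Suc k) / d) ^ k * exp (d * \<bar>x\<bar>)"
proof -
  let ?y = "d * \<bar>x\<bar> / real (Suc k)"
  have y: "0 \<le> ?y" using d by simp
  have "?y ^ k \<le> exp ?y ^ k"
    using y exp_ge_add_one_self[of ?y] by (intro power_mono) linarith+
  also have "\<dots> \<le> exp ?y ^ Suc k"
    using y by (intro power_increasing) auto
  also have "\<dots> = exp (d * \<bar>x\<bar>)"
    by (simp only: exp_of_nat_mult[symmetric]) (simp del: of_nat_Suc)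
  finally have "(real (Suc k) / d) ^ k * ?y ^ k \<le> (real (Suc k) / d) ^ k * exp (d * \<bar>x\<bar>)"
    using d by (intro mult_left_mono) auto
  moreover have "real (Suc k) / d * ?y = \<bar>x\<bar>" using d by (simp del: of_nat_Suc)
  ultimately show ?thesis by (simp only: power_mult_distrib[symmetric])
qed

context
  fixes F :: "real measure" and \<theta> d :: real
  assumes sets_F: "sets F = sets borel" and d: "d > 0"
    and dom: "\<theta> - d \<in> cgf_dom F" "\<theta> + d \<in> cgf_dom F"
begin

text \<open>The slack \<open>d'\<close> in the exponent pays for the power of x, and the two
  endpoint exponentials dominate \<open>exp (\<theta> x + d |x|)\<close>. The extra term
  \<open>e |x|\<close> is room for difference quotients.\<close>

lemma integrable_abs_power_exp:
  assumes \<eta>: "\<bar>\<eta> - \<theta>\<bar> + e < d" and e: "e \<ge> 0"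
  shows "integrable F (\<lambda>x. \<bar>x\<bar> ^ k * exp (\<eta> * x + e * \<bar>x\<bar>))"
proof -
  note [measurable_cong] = sets_F
  define d' where "d' = d - \<bar>\<eta> - \<theta>\<bar> - e"
  have d': "d' > 0" using \<eta> by (simp add: d'_def)
  let ?C = "(real (Suc k) / d') ^ k"
  have "integrable F (\<lambda>x. ?C * (exp ((\<theta> - d) * x) + exp ((\<theta> + d) * x)))"
    using dom by (auto simp: cgf_dom_def)
  then show ?thesis
  proof (rule Bochner_Integration.integrable_bound)
    show "AE x in F. norm (\<bar>x\<bar> ^ k * exp (\<eta> * x + e * \<bar>x\<bar>)) \<le> norm (?C * (exp ((\<theta> - d) * x) + exp ((\<theta> + d) * x)))"
    proof (intro AE_I2)
      fix x
      have "\<bar>x\<bar> ^ k * exp (\<eta> * x + e * \<bar>x\<bar>) \<le> ?C * exp (d' * \<bar>x\<bar>) * exp (\<eta> * x + e * \<bar>x\<bar>)"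
        by (intro mult_right_mono abs_power_le_exp d') auto
      also have "\<dots> = ?C * exp (d' * \<bar>x\<bar> + \<eta> * x + e * \<bar>x\<bar>)"
        by (simp add: exp_add)
      also have "\<dots> \<le> ?C * exp (\<theta> * x + d * \<bar>x\<bar>)"
      proof -
        have "(\<eta> - \<theta>) * x \<le> \<bar>\<eta> - \<theta>\<bar> * \<bar>x\<bar>" by (metis abs_ge_self abs_mult)
        then have "d' * \<bar>x\<bar> + \<eta> * x + e * \<bar>x\<bar> \<le> \<theta> * x + d * \<bar>x\<bar>"
          by (simp add: d'_def algebra_simps)
        then show ?thesis using d' by (intro mult_left_mono) auto
      qed
      also have "\<dots> \<le> ?C * (exp ((\<theta> - d) * x) + exp ((\<theta> + d) * x))"
      proof -
        have "exp (\<theta> * x + d * \<bar>x\<bar>) \<le> exp ((\<theta> - d) * x) + exp ((\<theta> + d) * x)"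
          by (cases "x \<ge> 0") (auto simp: algebra_simps)
        then show ?thesis using d' by (intro mult_left_mono) auto
      qed
      finally show "norm (\<bar>x\<bar> ^ k * exp (\<eta> * x + e * \<bar>x\<bar>)) \<le> norm (?C * (exp ((\<theta> - d) * x) + exp ((\<theta> + d) * x)))"
        using d' by (simp add: abs_mult)
    qed
  qed measurable
qed

lemma integrable_power_exp:
  assumes "\<bar>\<eta> - \<theta>\<bar> < d"
  shows "integrable F (\<lambda>x. x ^ k * exp (\<eta> * x))"
proof -
  note [measurable_cong] = sets_F
  show ?thesis
    by (rule Bochner_Integration.integrable_bound[OF integrable_abs_power_exp[of \<eta> 0 k]])
      (use assms in \<open>auto simp: abs_mult power_abs\<close>)
qed

lemma DERIV_power_exp_integral:
  assumes \<eta>: "\<bar>\<eta> - \<theta>\<bar> < d"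
  shows "((\<lambda>\<eta>. \<integral>x. x ^ k * exp (\<eta> * x) \<partial>F) has_real_derivative (\<integral>x. x ^ Suc k * exp (\<eta> * x) \<partial>F)) (at \<eta>)"
proof -
  note [measurable_cong] = sets_F
  \<comment> \<open>Half of the remaining gap: increments up to e leave the dominating exponent
    strictly inside d.\<close>
  define e where "e = (d - \<bar>\<eta> - \<theta>\<bar>) / 2"
  have e: "e > 0" "\<bar>\<eta> - \<theta>\<bar> + e < d" using \<eta> by (auto simp: e_def field_simps)
  let ?m = "\<lambda>\<eta>. \<integral>x. x ^ k * exp (\<eta> * x) \<partial>F"
  \<comment> \<open>Restricting the increments to an open interval bounds every term of the test
    sequences by e and does not change the limit at 0.\<close>
  have "((\<lambda>h. (?m (\<eta> + h) - ?m \<eta>) / h) \<longlongrightarrow> (\<integral>x. x ^ Suc k * exp (\<eta> * x) \<partial>F)) (at 0 within {-e<..<e})"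
    unfolding tendsto_at_iff_sequentially comp_def
  proof (intro allI impI)
    fix X :: "nat \<Rightarrow> real" assume X: "\<forall>i. X i \<in> {-e<..<e} - {0}" "X \<longlonglongrightarrow> 0"
    have Xe: "\<bar>X i\<bar> \<le> e" "X i \<noteq> 0" for i using X(1)[rule_format, of i] by auto
    have int: "integrable F (\<lambda>x. x ^ k * exp ((\<eta> + X i) * x))" for i
      using e(2) Xe(1)[of i] by (intro integrable_power_exp) linarith
    have "(?m (\<eta> + X i) - ?m \<eta>) / X i = (\<integral>x. x ^ k * exp (\<eta> * x) * ((exp (X i * x) - 1) / X i) \<partial>F)" for i
    proof -
      have "(?m (\<eta> + X i) - ?m \<eta>) / X i = (\<integral>x. (x ^ k * exp ((\<eta> + X i) * x) - x ^ k * exp (\<eta> * x)) / X i \<partial>F)"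
        using int integrable_power_exp[OF \<eta>] by simp
      also have "\<dots> = (\<integral>x. x ^ k * exp (\<eta> * x) * ((exp (X i * x) - 1) / X i) \<partial>F)"
        by (simp add: distrib_right exp_add right_diff_distrib mult.assoc)
      finally show ?thesis .
    qed
    moreover have "(\<lambda>i. \<integral>x. x ^ k * exp (\<eta> * x) * ((exp (X i * x) - 1) / X i) \<partial>F) \<longlonglongrightarrow> (\<integral>x. x ^ k * exp (\<eta> * x) * x \<partial>F)"
    proof (rule integral_dominated_convergence)
      show "integrable F (\<lambda>x. \<bar>x\<bar> ^ Suc k * exp (\<eta> * x + e * \<bar>x\<bar>))"
        using e by (intro integrable_abs_power_exp) auto
      show "AE x in F. norm (x ^ k * exp (\<eta> * x) * ((exp (X i * x) - 1) / X i)) \<le> \<bar>x\<bar> ^ Suc k * exp (\<eta> * x + e * \<bar>x\<bar>)" for i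
      proof (intro AE_I2)
        fix x
        have "\<bar>exp (X i * x) - 1\<bar> / \<bar>X i\<bar> \<le> \<bar>X i * x\<bar> * exp \<bar>X i * x\<bar> / \<bar>X i\<bar>"
          by (intro divide_right_mono abs_exp_minus_one_le) auto
        also have "\<dots> = \<bar>x\<bar> * exp (\<bar>X i\<bar> * \<bar>x\<bar>)" using Xe(2)[of i] by (simp add: abs_mult)
        also have "\<dots> \<le> \<bar>x\<bar> * exp (e * \<bar>x\<bar>)" using Xe(1)[of i] by (intro mult_left_mono) (auto intro!: mult_right_mono)
        finally have "\<bar>x\<bar> ^ k * exp (\<eta> * x) * (\<bar>exp (X i * x) - 1\<bar> / \<bar>X i\<bar>) \<le> \<bar>x\<bar> ^ k * exp (\<eta> * x) * (\<bar>x\<bar> * exp (e * \<bar>x\<bar>))"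
          by (intro mult_left_mono) auto
        then show "norm (x ^ k * exp (\<eta> * x) * ((exp (X i * x) - 1) / X i)) \<le> \<bar>x\<bar> ^ Suc k * exp (\<eta> * x + e * \<bar>x\<bar>)"
          by (simp add: abs_mult power_abs exp_add mult_ac)
      qed
      show "AE x in F. (\<lambda>i. x ^ k * exp (\<eta> * x) * ((exp (X i * x) - 1) / X i)) \<longlonglongrightarrow> x ^ k * exp (\<eta> * x) * x"
      proof (intro AE_I2 tendsto_mult tendsto_const)
        fix x
        have "((\<lambda>h. exp (h * x)) has_real_derivative x) (at 0)"
          by (auto intro!: derivative_eq_intros)
        then have "((\<lambda>h. (exp (h * x) - 1) / h) \<longlongrightarrow> x) (at 0)"
          by (simp add: DERIV_def)
        then show "(\<lambda>i. (exp (X i * x) - 1) / X i) \<longlonglongrightarrow> x"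
          unfolding tendsto_at_iff_sequentially comp_def using X(2) Xe(2) by auto
      qed
    qed measurable
    moreover have "(\<integral>x. x ^ k * exp (\<eta> * x) * x \<partial>F) = (\<integral>x. x ^ Suc k * exp (\<eta> * x) \<partial>F)"
      by (simp add: mult_ac)
    ultimately show "(\<lambda>i. (?m (\<eta> + X i) - ?m \<eta>) / X i) \<longlonglongrightarrow> (\<integral>x. x ^ Suc k * exp (\<eta> * x) \<partial>F)"
      by (simp only:)
  qed
  moreover have "at 0 within {-e<..<e} = at 0" using e(1) by (intro at_within_open) auto
  ultimately show ?thesis by (simp only: DERIV_def)
qed

context
  assumes F: "prob_space F"
begin

lemma exp_integral_pos:
  assumes "\<bar>\<eta> - \<theta>\<bar> < d"
  shows "(\<integral>x. exp (\<eta> * x) \<partial>F) > 0"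
proof -
  interpret prob_space F by (rule F)
  have "integrable F (\<lambda>x. exp (\<eta> * x))" using integrable_power_exp[OF assms, of 0] by simp
  then show ?thesis
    using prob_space_axioms by (intro expectation_greater) auto
qed

lemma DERIV_cgf:
  assumes "\<bar>\<eta> - \<theta>\<bar> < d"
  shows "(cgf F has_real_derivative ((\<integral>x. x * exp (\<eta> * x) \<partial>F) / (\<integral>x. exp (\<eta> * x) \<partial>F))) (at \<eta>)"
  unfolding cgf_def[abs_def]
  using DERIV_power_exp_integral[OF assms, of 0] exp_integral_pos[OF assms]
  by (auto intro!: derivative_eq_intros)

lemma deriv_cgf:
  "deriv (cgf F) \<theta> = (\<integral>x. x * exp (\<theta> * x) \<partial>F) / (\<integral>x. exp (\<theta> * x) \<partial>F)"
  using d by (intro DERIV_imp_deriv DERIV_cgf) auto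

text \<open>The right-hand side is the variance of the tilted law.\<close>

lemma deriv2_cgf:
  "deriv (deriv (cgf F)) \<theta> = (\<integral>x. x\<^sup>2 * exp (\<theta> * x) \<partial>F) / (\<integral>x. exp (\<theta> * x) \<partial>F)
     - ((\<integral>x. x * exp (\<theta> * x) \<partial>F) / (\<integral>x. exp (\<theta> * x) \<partial>F))\<^sup>2"
proof (rule DERIV_imp_deriv)
  let ?m = "\<lambda>k \<eta>. \<integral>x. x ^ k * exp (\<eta> * x) \<partial>F"
  have pos: "?m 0 \<theta> > 0" using exp_integral_pos[of \<theta>] d by simp
  have quot: "((\<lambda>\<eta>. ?m 1 \<eta> / ?m 0 \<eta>) has_real_derivative ((?m 2 \<theta> * ?m 0 \<theta> - ?m 1 \<theta> * ?m 1 \<theta>) / (?m 0 \<theta> * ?m 0 \<theta>))) (at \<theta>)"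
    using DERIV_divide[OF DERIV_power_exp_integral[of \<theta> 1] DERIV_power_exp_integral[of \<theta> 0]] pos d
    by (simp add: numeral_2_eq_2)
  \<comment> \<open>The formula for the first derivative is known only near \<theta>, which suffices
    for differentiating it there.\<close>
  have ev: "\<forall>\<^sub>F \<eta> in nhds \<theta>. ?m 1 \<eta> / ?m 0 \<eta> = deriv (cgf F) \<eta>"
  proof -
    have "\<forall>\<^sub>F \<eta> in nhds \<theta>. \<eta> \<in> ball \<theta> d" using d by (intro eventually_nhds_in_open) auto
    then show ?thesis
    proof eventually_elim
      fix \<eta> assume "\<eta> \<in> ball \<theta> d"
      then have "\<bar>\<eta> - \<theta>\<bar> < d" by (auto simp: dist_real_def)
      from DERIV_imp_deriv[OF DERIV_cgf[OF this]] show "?m 1 \<eta> / ?m 0 \<eta> = deriv (cgf F) \<eta>" by simp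
    qed
  qed
  have "(deriv (cgf F) has_real_derivative ((?m 2 \<theta> * ?m 0 \<theta> - ?m 1 \<theta> * ?m 1 \<theta>) / (?m 0 \<theta> * ?m 0 \<theta>))) (at \<theta>)"
    by (rule DERIV_cong_ev[THEN iffD1, OF refl ev refl quot])
  moreover have "(?m 2 \<theta> * ?m 0 \<theta> - ?m 1 \<theta> * ?m 1 \<theta>) / (?m 0 \<theta> * ?m 0 \<theta>) = ?m 2 \<theta> / ?m 0 \<theta> - (?m 1 \<theta> / ?m 0 \<theta>)\<^sup>2"
    using pos by (simp add: power2_eq_square diff_divide_distrib)
  ultimately show "(deriv (cgf F) has_real_derivative (\<integral>x. x\<^sup>2 * exp (\<theta> * x) \<partial>F) / (\<integral>x. exp (\<theta> * x) \<partial>F)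
     - ((\<integral>x. x * exp (\<theta> * x) \<partial>F) / (\<integral>x. exp (\<theta> * x) \<partial>F))\<^sup>2) (at \<theta>)"
    by simp
qed

end

end

lemma interior_cgf_dom_interval:
  "\<theta> \<in> interior (cgf_dom F) \<Longrightarrow> \<exists>d>0. \<theta> - d \<in> cgf_dom F \<and> \<theta> + d \<in> cgf_dom F"
proof -
  assume "\<theta> \<in> interior (cgf_dom F)"
  then obtain r where r: "r > 0" "cball \<theta> r \<subseteq> cgf_dom F" by (auto simp: mem_interior_cball)
  then show ?thesis by (intro exI[of _ r]) (auto simp: subset_iff dist_real_def)
qed

section \<open>Exponential tilting of i.i.d. sums\<close>

text \<open>On rectangles both sides factor, and rectangles determine the product measure. It serves
  for the tilting weights as well as for the truncation weights.\<close>

lemma PiM_density: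
  fixes w :: "'a \<Rightarrow> real"
  assumes I: "finite I" and M: "sigma_finite_measure M" and [measurable]: "w \<in> borel_measurable M"
    and w: "\<And>x. 0 \<le> w x" and D: "sigma_finite_measure (density M w)"
  shows "PiM I (\<lambda>_. density M w) = density (PiM I (\<lambda>_. M)) (\<lambda>x. \<Prod>i\<in>I. w (x i))"
proof (rule sym, rule product_sigma_finite.PiM_eqI)
  interpret M: product_sigma_finite "\<lambda>_. M" by (simp add: product_sigma_finite_def M)
  show "product_sigma_finite (\<lambda>_. density M w)" by (simp add: product_sigma_finite_def D)
  show "sets (density (PiM I (\<lambda>_. M)) (\<lambda>x. \<Prod>i\<in>I. w (x i))) = sets (PiM I (\<lambda>_. density M w))"
    by (simp cong: sets_PiM_cong)
  fix A assume "\<And>i. i \<in> I \<Longrightarrow> A i \<in> sets (density M w)"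
  then have A: "\<And>i. i \<in> I \<Longrightarrow> A i \<in> sets M" by simp
  have "emeasure (density (PiM I (\<lambda>_. M)) (\<lambda>x. \<Prod>i\<in>I. w (x i))) (PiE I A)
      = (\<integral>\<^sup>+x. ennreal (\<Prod>i\<in>I. w (x i)) * indicator (PiE I A) x \<partial>PiM I (\<lambda>_. M))"
    using A I by (intro emeasure_density sets_PiM_I_finite) auto
  also have "\<dots> = (\<integral>\<^sup>+x. (\<Prod>i\<in>I. ennreal (w (x i)) * indicator (A i) (x i)) \<partial>PiM I (\<lambda>_. M))"
  proof (intro nn_integral_cong)
    fix x assume x: "x \<in> space (PiM I (\<lambda>_. M))"
    have "indicator (PiE I A) x = (\<Prod>i\<in>I. indicator (A i) (x i) :: ennreal)"
    proof (cases "x \<in> PiE I A")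
      case True
      then have "x i \<in> A i" if "i \<in> I" for i using that by auto
      with True show ?thesis by simp
    next
      case False
      then obtain i where "i \<in> I" "x i \<notin> A i" using x by (auto simp: space_PiM PiE_iff)
      then have "(\<Prod>i\<in>I. indicator (A i) (x i) :: ennreal) = 0" by (intro prod_zero I bexI[of _ i]) auto
      with False show ?thesis by simp
    qed
    then show "ennreal (\<Prod>i\<in>I. w (x i)) * indicator (PiE I A) x = (\<Prod>i\<in>I. ennreal (w (x i)) * indicator (A i) (x i))"
      by (simp add: prod.distrib prod_ennreal w)
  qed
  also have "\<dots> = (\<Prod>i\<in>I. \<integral>\<^sup>+x. ennreal (w x) * indicator (A i) x \<partial>M)"
    using A I by (intro M.product_nn_integral_prod) auto
  also have "\<dots> = (\<Prod>i\<in>I. emeasure (density M w) (A i))"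
    using A by (intro prod.cong refl emeasure_density[symmetric]) auto
  finally show "emeasure (density (PiM I (\<lambda>_. M)) (\<lambda>x. \<Prod>i\<in>I. w (x i))) (PiE I A) = (\<Prod>i\<in>I. emeasure (density M w) (A i))" .
qed fact

locale iid_real = prob_space G for G :: "real measure" +
  fixes b :: real
  assumes sets_G [measurable_cong]: "sets G = sets borel"
begin

abbreviation P where "P I \<equiv> PiM I (\<lambda>_::nat. G)"

text \<open>Index sets are arbitrary because one coordinate will be split off from the sum.\<close>

definition T :: "nat set \<Rightarrow> (nat \<Rightarrow> real) \<Rightarrow> real" where
  "T I x = (\<Sum>i\<in>I. x i - b)"

definition law :: "nat set \<Rightarrow> real measure" where
  "law I = distr (P I) borel (T I)"

definition centered_law :: "real measure" where
  "centered_law = distr G borel (\<lambda>x. x - b)"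

lemma prob_space_P: "prob_space (P I)"
  by (intro prob_space_PiM prob_space_axioms)

lemma T_measurable [measurable]: "T I \<in> borel_measurable (P I)"
  unfolding T_def by measurable

lemma real_distribution_law: "real_distribution (law I)"
  unfolding law_def by (rule prob_space.real_distribution_distr[OF prob_space_P]) measurable

lemma real_distribution_centered_law: "real_distribution centered_law"
  unfolding centered_law_def by (rule real_distribution_distr) measurable

lemma char_law:
  assumes I: "finite I"
  shows "char (law I) t = char centered_law t ^ card I"
proof -
  interpret product_sigma_finite "\<lambda>_::nat. G"
    by (simp add: product_sigma_finite_def sigma_finite_measure_axioms)
  have "char (law I) t = (CLINT x|P I. iexp (t * T I x))"
    unfolding char_def law_def by (rule integral_distr) measurable
  also have "\<dots> = (CLINT x|P I. (\<Prod>i\<in>I. iexp (t * (x i - b))))"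
    by (simp add: T_def sum_distrib_left exp_sum[OF I])
  also have "\<dots> = (\<Prod>i\<in>I. CLINT x|G. iexp (t * (x - b)))"
    using I by (intro product_integral_prod integrable_const_bound[where B = 1]) (auto simp del: of_real_mult of_real_diff)
  also have "(CLINT x|G. iexp (t * (x - b))) = char centered_law t"
    unfolding char_def centered_law_def by (rule integral_distr[symmetric]) measurable
  finally show ?thesis by simp
qed

lemma integral_law:
  fixes f :: "real \<Rightarrow> real"
  assumes [measurable]: "f \<in> borel_measurable borel"
  shows "(\<integral>x. f x \<partial>law I) = (\<integral>x. f (T I x) \<partial>P I)"
  unfolding law_def by (rule integral_distr) measurable

text \<open>Condition on coordinate \<open>i\<close>: the uniformity of \<open>tail\<close> in \<open>y\<close> absorbs the shift it causes.\<close>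

lemma exp_tail_with_large_coordinate:
  assumes \<theta>: "\<theta> > 0" and I: "finite I" "i \<notin> I" and K: "K \<ge> 0"
    and tail: "\<And>y. (\<integral>x. indicator {y..} x * exp (- \<theta> * (x - y)) \<partial>law I) \<le> K"
  shows "(\<integral>x. indicator {0..} (T (insert i I) x) * exp (- \<theta> * T (insert i I) x) * indicator {u<..} (x i) \<partial>P (insert i I))
    \<le> K * measure G {u<..}"
proof -
  interpret product_sigma_finite "\<lambda>_::nat. G"
    by (simp add: product_sigma_finite_def sigma_finite_measure_axioms)
  interpret L: real_distribution "law I" by (rule real_distribution_law)
  interpret PI: prob_space "P (insert i I)" by (rule prob_space_P)
  let ?f = "\<lambda>x. indicator {0..} (T (insert i I) x) * exp (- \<theta> * T (insert i I) x) * indicator {u<..} (x i) :: real"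
  have f01: "0 \<le> ?f x" "?f x \<le> 1" for x using \<theta> by (auto simp: indicator_def)
  have [measurable]: "?f \<in> borel_measurable (P (insert i I))" by measurable
  have intf: "integrable (P (insert i I)) ?f"
    using f01 by (intro PI.integrable_const_bound[where B = 1]) auto
  \<comment> \<open>Freezing coordinate i at y shifts the remaining sum by \<open>y - b\<close>, so
    its half-line starts at \<open>b - y\<close>.\<close>
  have upd: "T (insert i I) (x(i := y)) = T I x - (b - y)" for x y
  proof -
    have "(\<Sum>j\<in>I. (x(i := y)) j - b) = (\<Sum>j\<in>I. x j - b)"
      using I by (intro sum.cong) auto
    then show ?thesis using I by (simp add: T_def)
  qed
  have "ennreal (\<integral>x. ?f x \<partial>P (insert i I)) = (\<integral>\<^sup>+x. ennreal (?f x) \<partial>P (insert i I))"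
    using intf f01 by (intro nn_integral_eq_integral[symmetric]) auto
  also have "\<dots> = (\<integral>\<^sup>+y. \<integral>\<^sup>+x. ennreal (?f (x(i := y))) \<partial>P I \<partial>G)"
    using I by (intro product_nn_integral_insert_rev) measurable
  also have "\<dots> \<le> (\<integral>\<^sup>+y. ennreal K * indicator {u<..} y \<partial>G)"
  proof (intro nn_integral_mono)
    fix y
    let ?g = "\<lambda>z. indicator {b - y..} z * exp (- \<theta> * (z - (b - y))) :: real"
    have "(\<integral>\<^sup>+x. ennreal (?f (x(i := y))) \<partial>P I) = (\<integral>\<^sup>+x. ennreal (?g (T I x)) * indicator {u<..} y \<partial>P I)"
      by (intro nn_integral_cong) (auto simp: upd indicator_def)
    also have "\<dots> = (\<integral>\<^sup>+x. ennreal (?g (T I x)) \<partial>P I) * indicator {u<..} y"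
      by (rule nn_integral_multc) measurable
    also have "(\<integral>\<^sup>+x. ennreal (?g (T I x)) \<partial>P I) = (\<integral>\<^sup>+z. ennreal (?g z) \<partial>law I)"
      unfolding law_def by (rule nn_integral_distr[symmetric]) measurable
    also have "\<dots> = ennreal (\<integral>z. ?g z \<partial>law I)"
      using \<theta> by (intro nn_integral_eq_integral L.integrable_const_bound[where B = 1]) (auto simp: indicator_def)
    also have "\<dots> \<le> ennreal K" using tail by (rule ennreal_leI)
    finally show "(\<integral>\<^sup>+x. ennreal (?f (x(i := y))) \<partial>P I) \<le> ennreal K * indicator {u<..} y"
      by (simp only: mult_right_mono zero_le)
  qed
  also have "\<dots> = ennreal K * emeasure G {u<..}"
    by (rule nn_integral_cmult_indicator) measurable
  also have "\<dots> = ennreal (K * measure G {u<..})"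
    using K by (simp add: emeasure_eq_measure ennreal_mult)
  finally show ?thesis using K by (subst (asm) ennreal_le_iff) auto
qed

end

text \<open>Change of measure: with \<open>G\<close> the exponential tilt of \<open>F\<close>, the weight of a configuration
  depends only on the sum.\<close>

lemma (in iid_real) measure_PiM_untilt:
  assumes F: "prob_space F" "F = density G (\<lambda>x. ennreal (exp (\<psi> - \<theta> * x)))"
    and A [measurable]: "Measurable.pred (P {..<n}) A"
  shows "measure (PiM {..<n} (\<lambda>_. F)) {x \<in> space (PiM {..<n} (\<lambda>_. F)). A x}
    = exp (real n * \<psi> - \<theta> * (b * real n)) * (\<integral>x. exp (- \<theta> * T {..<n} x) * indicator {x. A x} x \<partial>P {..<n})"
proof -
  interpret F: prob_space F by (rule F)
  let ?D = "density (P {..<n}) (\<lambda>x. ennreal (\<Prod>i<n. exp (\<psi> - \<theta> * x i)))"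
  have eq: "PiM {..<n} (\<lambda>_. F) = ?D"
    unfolding F(2) by (rule PiM_density)
      (use F.sigma_finite_measure_axioms sigma_finite_measure_axioms in \<open>auto simp flip: F(2)\<close>)
  have sp: "space ?D = space (P {..<n})" by simp
  have "measure ?D {x \<in> space ?D. A x} = (\<integral>x. indicator {x \<in> space ?D. A x} x \<partial>?D)"
    unfolding Bochner_Integration.integral_indicator by (intro arg_cong2[where f = measure]) auto
  also have "\<dots> = (\<integral>x. (\<Prod>i<n. exp (\<psi> - \<theta> * x i)) *\<^sub>R indicator {x \<in> space ?D. A x} x \<partial>P {..<n})"
    unfolding sp by (rule integral_density) (auto intro!: prod_nonneg)
  also have "\<dots> = (\<integral>x. exp (real n * \<psi> - \<theta> * (b * real n)) * (exp (- \<theta> * T {..<n} x) * indicator {x. A x} x) \<partial>P {..<n})"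
  proof (intro Bochner_Integration.integral_cong refl)
    fix x assume "x \<in> space (P {..<n})"
    moreover have "(\<Prod>i<n. exp (\<psi> - \<theta> * x i)) = exp (real n * \<psi> - \<theta> * (b * real n)) * exp (- \<theta> * T {..<n} x)"
      by (simp add: exp_sum[symmetric] exp_add[symmetric] T_def sum_subtractf sum_distrib_left sum_negf algebra_simps)
    ultimately show "(\<Prod>i<n. exp (\<psi> - \<theta> * x i)) *\<^sub>R indicator {x \<in> space ?D. A x} x
        = exp (real n * \<psi> - \<theta> * (b * real n)) * (exp (- \<theta> * T {..<n} x) * indicator {x. A x} x)"
      by (auto simp: indicator_def)
  qed
  finally show ?thesis unfolding eq by simp
qed

section \<open>Truncation\<close>

lemma prob_trunc_dist:
  assumes F: "prob_space F" "sets F = sets borel" and u: "measure F {..u} > 0"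
  shows "prob_space (trunc_dist F u)"
proof (rule prob_spaceI)
  interpret prob_space F by (rule F)
  have [measurable_cong]: "sets F = sets borel" by (rule F)
  have sp: "space F = UNIV" using sets_eq_imp_space_eq[OF F(2)] by simp
  define m where "m = measure F {..u}"
  have m: "m > 0" using u by (simp add: m_def)
  have tr: "trunc_dist F u = density F (\<lambda>x. ennreal (indicator {..u} x / m))"
    unfolding trunc_dist_def m_def ..
  have "emeasure (density F (\<lambda>x. ennreal (indicator {..u} x / m))) (space F)
      = (\<integral>\<^sup>+x. ennreal (indicator {..u} x / m) * indicator (space F) x \<partial>F)"
    by (rule emeasure_density) measurable
  also have "\<dots> = (\<integral>\<^sup>+x. ennreal (indicator {..u} x / m) \<partial>F)"
    by (intro nn_integral_cong) simp
  also have "\<dots> = ennreal (\<integral>x. indicator {..u} x / m \<partial>F)"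
    using m by (intro nn_integral_eq_integral integrable_const_bound[where B = "1 / m"] AE_I2)
      (auto simp: indicator_def)
  also have "(\<integral>x. indicator {..u} x / m \<partial>F) = 1"
    using m by (simp add: sp) (simp add: m_def)
  finally show "emeasure (trunc_dist F u) (space (trunc_dist F u)) = 1" unfolding tr space_density by simp
qed

text \<open>The product of truncated laws has a constant density, \<open>F(u)\<close> to the power
  -n, on the cube where all coordinates are at most u.\<close>

lemma tail_prob_trunc_dist:
  assumes F: "prob_space F" "sets F = sets borel" and u: "measure F {..u} > 0"
  shows "tail_prob (trunc_dist F u) n \<gamma> * measure F {..u} ^ n
    = measure (PiM {..<n} (\<lambda>_. F)) {x \<in> space (PiM {..<n} (\<lambda>_. F)). \<gamma> \<le> (\<Sum>i<n. x i) \<and> (\<forall>i<n. x i \<le> u)}"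
proof -
  interpret prob_space F by (rule F)
  interpret tr: prob_space "trunc_dist F u" by (rule prob_trunc_dist[OF assms])
  have [measurable_cong]: "sets F = sets borel" by (rule F)
  define m where "m = measure F {..u}"
  have m: "m > 0" using u by (simp add: m_def)
  let ?w = "\<lambda>x. indicator {..u} x / m"
  let ?D = "density (PiM {..<n} (\<lambda>_. F)) (\<lambda>x. ennreal (\<Prod>i<n. ?w (x i)))"
  let ?S = "{x \<in> space (PiM {..<n} (\<lambda>_. F)). \<gamma> \<le> (\<Sum>i<n. x i)}"
  let ?S' = "{x \<in> space (PiM {..<n} (\<lambda>_. F)). \<gamma> \<le> (\<Sum>i<n. x i) \<and> (\<forall>i<n. x i \<le> u)}"
  have trd: "trunc_dist F u = density F (\<lambda>x. ennreal (?w x))"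
    unfolding trunc_dist_def m_def ..
  have eq: "PiM {..<n} (\<lambda>_. trunc_dist F u) = ?D"
    unfolding trd
  proof (rule PiM_density)
    show "sigma_finite_measure (density F (\<lambda>x. ennreal (?w x)))"
      unfolding trd[symmetric] by (rule tr.sigma_finite_measure_axioms)
  qed (use m sigma_finite_measure_axioms in auto)
  have "tail_prob (trunc_dist F u) n \<gamma> = measure ?D ?S"
    unfolding tail_prob_def eq by simp
  also have "\<dots> = (\<integral>x. indicator ?S x \<partial>?D)"
    unfolding Bochner_Integration.integral_indicator by (intro arg_cong2[where f = measure]) auto
  also have "\<dots> = (\<integral>x. (\<Prod>i<n. ?w (x i)) *\<^sub>R indicator ?S x \<partial>PiM {..<n} (\<lambda>_. F))"
    using m by (intro integral_density) (auto intro!: prod_nonneg)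
  also have "\<dots> = (\<integral>x. indicator ?S' x / m ^ n \<partial>PiM {..<n} (\<lambda>_. F))"
  proof (intro Bochner_Integration.integral_cong refl)
    fix x
    have "(\<Prod>i<n. ?w (x i)) = indicator {x. \<forall>i<n. x i \<le> u} x / m ^ n"
    proof (cases "\<forall>i<n. x i \<le> u")
      case False
      then obtain i where "i < n" "\<not> x i \<le> u" by blast
      then have "(\<Prod>i<n. ?w (x i)) = 0" by (intro prod_zero bexI[of _ i]) auto
      with False show ?thesis by simp
    qed (simp add: prod_dividef power_one_over)
    then show "(\<Prod>i<n. ?w (x i)) *\<^sub>R indicator ?S x = indicator ?S' x / m ^ n"
      by (auto simp: indicator_def)
  qed
  also have "\<dots> = measure (PiM {..<n} (\<lambda>_. F)) ?S' / m ^ n"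
  proof -
    have "?S' \<inter> space (PiM {..<n} (\<lambda>_. F)) = ?S'" by auto
    then show ?thesis by simp
  qed
  finally show ?thesis using m unfolding m_def by simp
qed

text \<open>The difference is the probability that the sum is large and some coordinate exceeds u,
  estimated by a union bound. Each term keeps both constraints, since the tilt has to exploit them
  jointly.\<close>

lemma tail_prob_truncation_defect:
  assumes F: "prob_space F" "sets F = sets borel" and u: "measure F {..u} > 0"
  shows "\<bar>tail_prob F n \<gamma> - tail_prob (trunc_dist F u) n \<gamma> * measure F {..u} ^ n\<bar>
    \<le> (\<Sum>i<n. measure (PiM {..<n} (\<lambda>_. F)) {x \<in> space (PiM {..<n} (\<lambda>_. F)). \<gamma> \<le> (\<Sum>i<n. x i) \<and> x i > u})"
proof -
  let ?P = "PiM {..<n} (\<lambda>_. F)"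
  interpret PF: prob_space ?P using F by (intro prob_space_PiM)
  have [measurable_cong]: "sets F = sets borel" by (rule F)
  let ?S = "{x \<in> space ?P. \<gamma> \<le> (\<Sum>i<n. x i)}"
  let ?S' = "{x \<in> space ?P. \<gamma> \<le> (\<Sum>i<n. x i) \<and> (\<forall>i<n. x i \<le> u)}"
  let ?R = "\<lambda>i. {x \<in> space ?P. \<gamma> \<le> (\<Sum>i<n. x i) \<and> x i > u}"
  have [measurable]: "?S \<in> sets ?P" "?S' \<in> sets ?P" by measurable
  have R: "?R i \<in> sets ?P" if "i < n" for i
  proof -
    have "(\<lambda>x. x i) \<in> measurable ?P F" using that by (intro measurable_component_singleton) auto
    then have [measurable]: "(\<lambda>x. x i) \<in> borel_measurable ?P"
      using measurable_cong_sets[OF refl F(2)] by blast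
    show ?thesis by measurable
  qed
  have sub: "?S' \<subseteq> ?S" by auto
  have "measure ?P ?S - measure ?P ?S' = measure ?P (?S - ?S')"
    by (rule PF.finite_measure_Diff[symmetric]) (auto intro: sub)
  also have "?S - ?S' \<subseteq> (\<Union>i<n. ?R i)" by (auto simp: not_le)
  then have "measure ?P (?S - ?S') \<le> measure ?P (\<Union>i<n. ?R i)"
    using R by (intro PF.finite_measure_mono) auto
  also have "\<dots> \<le> (\<Sum>i<n. measure ?P (?R i))"
    using R by (intro PF.finite_measure_subadditive_finite) auto
  finally have "measure ?P ?S - measure ?P ?S' \<le> (\<Sum>i<n. measure ?P (?R i))" .
  moreover have "measure ?P ?S' \<le> measure ?P ?S"
    by (rule PF.finite_measure_mono[OF sub]) measurable
  ultimately show ?thesis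
    unfolding tail_prob_trunc_dist[OF assms] unfolding tail_prob_def by simp
qed

lemma exp_markov:
  assumes F: "sets F = sets borel" and int: "integrable F (\<lambda>x. exp (s * x))" and s: "s \<ge> 0" and fin: "finite_measure F"
  shows "measure F {u<..} \<le> exp (- s * u) * (\<integral>x. exp (s * x) \<partial>F)"
proof -
  interpret finite_measure F by (rule fin)
  have [measurable_cong]: "sets F = sets borel" by (rule F)
  have sp: "space F = UNIV" using sets_eq_imp_space_eq[OF F] by simp
  have "measure F {u<..} = (\<integral>x. indicator {u<..} x \<partial>F)" by (simp add: sp)
  also have "\<dots> \<le> (\<integral>x. exp (- s * u) * exp (s * x) \<partial>F)"
  proof (rule integral_mono)
    fix x show "indicator {u<..} x \<le> exp (- s * u) * exp (s * x)"
      using s by (auto simp: indicator_def exp_add[symmetric] mult_left_mono)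
  qed (use int in \<open>auto intro!: integrable_const_bound[where B = 1]\<close>)
  finally show ?thesis by simp
qed

text \<open>Bernoulli's inequality; meant for \<open>q n\<close> the mass below the truncation
  level.\<close>

lemma power_tendsto_1:
  fixes q :: "nat \<Rightarrow> real"
  assumes q: "\<And>n. 0 \<le> q n" "\<And>n. q n \<le> 1" and lim: "(\<lambda>n. real n * (1 - q n)) \<longlonglongrightarrow> 0"
  shows "(\<lambda>n. q n ^ n) \<longlonglongrightarrow> 1"
proof (rule tendsto_sandwich)
  show "\<forall>\<^sub>F n in sequentially. 1 - real n * (1 - q n) \<le> q n ^ n"
  proof (intro always_eventually allI)
    fix n
    show "1 - real n * (1 - q n) \<le> q n ^ n"
      using Bernoulli_inequality[of "q n - 1" n] q(1)[of n] by (simp add: algebra_simps)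
  qed
  show "\<forall>\<^sub>F n in sequentially. q n ^ n \<le> 1"
    using q by (intro always_eventually allI power_le_one) auto
  show "(\<lambda>n. 1 - real n * (1 - q n)) \<longlonglongrightarrow> 1" using tendsto_diff[OF tendsto_const lim, of 1] by simp
qed auto

text \<open>Everything is measured on the scale c, where p has a positive limit; there
  \<open>o(p)\<close> means that the rescaled difference vanishes. Q stands for the normalising
  power of the truncation, R for the union bound.\<close>

lemma truncation_negligible:
  fixes c p q Q R :: "nat \<Rightarrow> real"
  assumes p: "(\<lambda>n. c n * p n) \<longlonglongrightarrow> L" and L: "L > 0"
    and bound: "\<forall>\<^sub>F n in sequentially. \<bar>p n - q n * Q n\<bar> \<le> R n" and c0: "\<And>n. c n \<ge> 0"
    and R: "(\<lambda>n. c n * R n) \<longlonglongrightarrow> 0" and Q: "Q \<longlonglongrightarrow> 1"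
  shows "(\<lambda>n. c n * q n) \<longlonglongrightarrow> L" "(\<lambda>n. q n - p n) \<in> o(p)"
proof -
  have "\<forall>\<^sub>F n in sequentially. norm (c n * (p n - q n * Q n)) \<le> c n * R n"
    using bound by eventually_elim (simp add: abs_mult c0 mult_left_mono)
  then have "(\<lambda>n. c n * (p n - q n * Q n)) \<longlonglongrightarrow> 0" by (rule Lim_null_comparison[OF _ R])
  from tendsto_diff[OF p this] have "(\<lambda>n. c n * q n * Q n) \<longlonglongrightarrow> L" by (simp add: algebra_simps)
  from tendsto_divide[OF this Q] have "(\<lambda>n. c n * q n * Q n / Q n) \<longlonglongrightarrow> L" by simp
  moreover have "\<forall>\<^sub>F n in sequentially. c n * q n * Q n / Q n = c n * q n"
    using order_tendstoD(1)[OF Q, of 0] by (auto elim!: eventually_mono)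
  ultimately show lim: "(\<lambda>n. c n * q n) \<longlonglongrightarrow> L" by (rule Lim_transform_eventually)
  have ev: "\<forall>\<^sub>F n in sequentially. c n * p n > 0" using p L by (rule order_tendstoD(1))
  show "(\<lambda>n. q n - p n) \<in> o(p)"
  proof (rule smalloI_tendsto)
    have "(\<lambda>n. (c n * q n - c n * p n) / (c n * p n)) \<longlonglongrightarrow> (L - L) / L"
      using L by (intro tendsto_divide tendsto_diff lim p) auto
    then have "(\<lambda>n. (c n * q n - c n * p n) / (c n * p n)) \<longlonglongrightarrow> 0" by simp
    moreover have "\<forall>\<^sub>F n in sequentially. (c n * q n - c n * p n) / (c n * p n) = (q n - p n) / p n"
      using ev by eventually_elim (auto simp: right_diff_distrib[symmetric])
    ultimately show "(\<lambda>n. (q n - p n) / p n) \<longlonglongrightarrow> 0" by (rule Lim_transform_eventually)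
    show "\<forall>\<^sub>F n in sequentially. p n \<noteq> 0" using ev by eventually_elim auto
  qed
qed

section \<open>The law tilted to mean b\<close>

locale cramer_tilt =
  fixes F :: "real measure" and \<theta> d b :: real
  assumes prob_F: "prob_space F" and sets_F: "sets F = sets borel"
    and d: "d > 0" and dom: "\<theta> - d \<in> cgf_dom F" "\<theta> + d \<in> cgf_dom F"
    and saddle: "deriv (cgf F) \<theta> = b"
    and nondegenerate: "\<not> (AE x in F. x = b)"
begin

sublocale F: prob_space F by (rule prob_F)

definition m :: "nat \<Rightarrow> real" where "m k = (\<integral>x. x ^ k * exp (\<theta> * x) \<partial>F)"

definition w :: "real \<Rightarrow> real" where "w x = exp (\<theta> * x - cgf F \<theta>)"

definition G :: "real measure" where "G = density F (\<lambda>x. ennreal (w x))"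

definition \<sigma> :: real where "\<sigma> = sqrt (deriv (deriv (cgf F)) \<theta>)"

lemma F_measurable [measurable_cong]: "sets F = sets borel" by (rule sets_F)

lemma w_measurable [measurable]: "w \<in> borel_measurable borel"
  unfolding w_def by measurable

lemma integrable_m: "integrable F (\<lambda>x. x ^ k * exp (\<theta> * x))"
  by (rule integrable_power_exp[OF sets_F d dom]) (use d in auto)

lemma m0_pos: "m 0 > 0"
  unfolding m_def using exp_integral_pos[OF sets_F d dom prob_F, of \<theta>] d by simp

lemma exp_cgf: "exp (cgf F \<theta>) = m 0"
  using m0_pos by (simp add: cgf_def m_def)

lemma w_eq: "w x = exp (\<theta> * x) / m 0"
  by (simp add: w_def exp_diff exp_cgf)

lemma w_pos: "w x > 0"
  by (simp add: w_def)

lemma m1_eq: "m 1 = b * m 0"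
  using deriv_cgf[OF sets_F d dom prob_F] saddle m0_pos by (simp add: m_def)

lemma deriv2_eq: "deriv (deriv (cgf F)) \<theta> = m 2 / m 0 - b\<^sup>2"
  using deriv2_cgf[OF sets_F d dom prob_F] deriv_cgf[OF sets_F d dom prob_F] saddle
  by (simp add: m_def)

lemma sets_G: "sets G = sets borel"
  by (simp add: G_def sets_F)

lemma integral_G:
  fixes f :: "real \<Rightarrow> real"
  assumes [measurable]: "f \<in> borel_measurable borel"
  shows "(\<integral>x. f x \<partial>G) = (\<integral>x. f x * exp (\<theta> * x) \<partial>F) / m 0"
proof -
  have "(\<integral>x. f x \<partial>G) = (\<integral>x. w x *\<^sub>R f x \<partial>F)"
    unfolding G_def by (rule integral_density) (auto simp: less_imp_le[OF w_pos])
  also have "\<dots> = (\<integral>x. f x * exp (\<theta> * x) / m 0 \<partial>F)"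
    by (simp add: w_eq mult.commute)
  finally show ?thesis by simp
qed

lemma integrable_G:
  fixes f :: "real \<Rightarrow> real"
  assumes [measurable]: "f \<in> borel_measurable borel" and int: "integrable F (\<lambda>x. f x * exp (\<theta> * x))"
  shows "integrable G f"
proof -
  have "integrable F (\<lambda>x. w x *\<^sub>R f x)"
    using integrable_divide[OF int, of "m 0"] by (simp add: w_eq mult.commute)
  then show ?thesis
    unfolding G_def by (subst integrable_density) (auto simp: less_imp_le[OF w_pos])
qed

lemma prob_space_G: "prob_space G"
proof (rule prob_spaceI)
  have "emeasure G (space G) = (\<integral>\<^sup>+x. ennreal (w x) * indicator (space F) x \<partial>F)"
    unfolding G_def space_density by (rule emeasure_density) measurable
  also have "\<dots> = (\<integral>\<^sup>+x. ennreal (w x) \<partial>F)"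
    by (intro nn_integral_cong) simp
  also have "\<dots> = ennreal (\<integral>x. w x \<partial>F)"
    using integrable_m[of 0] m0_pos by (intro nn_integral_eq_integral) (auto simp: w_eq)
  also have "(\<integral>x. w x \<partial>F) = 1"
    using m0_pos by (simp add: w_eq) (simp add: m_def)
  finally show "emeasure G (space G) = 1" by simp
qed

sublocale iid_real G b
  using prob_space_G sets_G by (simp add: iid_real_def iid_real_axioms_def)

text \<open>The weight is positive everywhere, so lattice structure and nondegeneracy pass between F
  and G.\<close>

lemma AE_G_iff: "(AE x in G. A x) \<longleftrightarrow> (AE x in F. A x)"
  unfolding G_def by (subst AE_density) (simp_all add: w_pos)

lemma F_eq_density_G: "F = density G (\<lambda>x. ennreal (exp (cgf F \<theta> - \<theta> * x)))"
proof -
  have "density G (\<lambda>x. ennreal (exp (cgf F \<theta> - \<theta> * x))) = density F (\<lambda>x. ennreal (w x) * ennreal (exp (cgf F \<theta> - \<theta> * x)))"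
    unfolding G_def by (rule density_density_eq) measurable
  also have "\<dots> = density F (\<lambda>x. 1)"
    by (intro arg_cong2[where f = density] ext refl) (simp add: w_def ennreal_mult[symmetric] exp_add[symmetric])
  finally show ?thesis by (simp add: density_1)
qed

lemma square_moment: "integrable G (\<lambda>x. (x - b)\<^sup>2)" "(\<integral>x. (x - b)\<^sup>2 \<partial>G) = deriv (deriv (cgf F)) \<theta>"
proof -
  have eq: "(x - b)\<^sup>2 * exp (\<theta> * x) = x ^ 2 * exp (\<theta> * x) - 2 * b * (x ^ 1 * exp (\<theta> * x)) + b\<^sup>2 * (x ^ 0 * exp (\<theta> * x))" for x
    by (simp add: power2_eq_square algebra_simps)
  show "integrable G (\<lambda>x. (x - b)\<^sup>2)"
    by (rule integrable_G) (simp, unfold eq, intro Bochner_Integration.integrable_add Bochner_Integration.integrable_diff integrable_mult_right integrable_m)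
  have "(\<integral>x. (x - b)\<^sup>2 \<partial>G) = (\<integral>x. x ^ 2 * exp (\<theta> * x) - 2 * b * (x ^ 1 * exp (\<theta> * x)) + b\<^sup>2 * (x ^ 0 * exp (\<theta> * x)) \<partial>F) / m 0"
    by (subst integral_G) (simp, simp only: eq)
  also have "(\<integral>x. x ^ 2 * exp (\<theta> * x) - 2 * b * (x ^ 1 * exp (\<theta> * x)) + b\<^sup>2 * (x ^ 0 * exp (\<theta> * x)) \<partial>F)
     = m 2 - 2 * b * m 1 + b\<^sup>2 * m 0"
    unfolding m_def
    by (simp only: Bochner_Integration.integral_add Bochner_Integration.integral_diff integral_mult_right_zero
      Bochner_Integration.integrable_diff integrable_mult_right integrable_m)
  also have "\<dots> / m 0 = m 2 / m 0 - b\<^sup>2"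
    using m0_pos by (simp add: m1_eq[simplified] field_simps power2_eq_square)
  finally show "(\<integral>x. (x - b)\<^sup>2 \<partial>G) = deriv (deriv (cgf F)) \<theta>"
    by (simp add: deriv2_eq)
qed

text \<open>It is the variance of G around its mean b; if it were 0, G and therefore F would sit at
  the single point b.\<close>

lemma deriv2_pos: "deriv (deriv (cgf F)) \<theta> > 0"
proof -
  have "(\<integral>x. (x - b)\<^sup>2 \<partial>G) \<noteq> 0"
  proof
    assume "(\<integral>x. (x - b)\<^sup>2 \<partial>G) = 0"
    then have "AE x in G. (x - b)\<^sup>2 = 0"
      using square_moment(1) by (subst integral_nonneg_eq_0_iff_AE[symmetric]) auto
    then show False using nondegenerate by (simp add: AE_G_iff)
  qed
  moreover have "(\<integral>x. (x - b)\<^sup>2 \<partial>G) \<ge> 0" by (intro integral_nonneg_AE) auto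
  ultimately show ?thesis unfolding square_moment(2) by simp
qed

lemma \<sigma>_squared: "\<sigma>\<^sup>2 = deriv (deriv (cgf F)) \<theta>"
  using deriv2_pos by (simp add: \<sigma>_def)

sublocale C: centered_distribution centered_law \<sigma>
proof -
  interpret C: real_distribution centered_law by (rule real_distribution_centered_law)
  show "centered_distribution centered_law \<sigma>"
  proof
    show "\<sigma> > 0" using deriv2_pos by (simp add: \<sigma>_def)
    show "integrable centered_law (\<lambda>x. x\<^sup>2)"
      unfolding centered_law_def using square_moment(1) by (subst integrable_distr_eq) auto
    show "(\<integral>x. x\<^sup>2 \<partial>centered_law) = \<sigma>\<^sup>2"
      unfolding centered_law_def using square_moment(2) by (subst integral_distr) (auto simp: \<sigma>_squared)
    have "(\<integral>x. x \<partial>centered_law) = (\<integral>x. x - b \<partial>G)"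
      unfolding centered_law_def by (rule integral_distr) measurable
    also have "\<dots> = (\<integral>x. x ^ 1 * exp (\<theta> * x) - b * (x ^ 0 * exp (\<theta> * x)) \<partial>F) / m 0"
      by (subst integral_G) (auto simp: algebra_simps)
    also have "(\<integral>x. x ^ 1 * exp (\<theta> * x) - b * (x ^ 0 * exp (\<theta> * x)) \<partial>F) = m 1 - b * m 0"
      unfolding m_def
      by (simp only: Bochner_Integration.integral_diff integral_mult_right_zero integrable_mult_right integrable_m)
    also have "\<dots> = 0" by (simp add: m1_eq[simplified])
    finally show "(\<integral>x. x \<partial>centered_law) = 0" by simp
  qed
qed

text \<open>Translates lattice properties of F into the Fourier hypotheses: a non-lattice F excludes
  the second alternative for all t, and a span h excludes it for
  \<open>|t| < 2 * pi / h\<close>.\<close>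

lemma char_lt_1_or_lattice:
  assumes t: "t \<noteq> 0"
  shows "cmod (char centered_law t) < 1 \<or> lattice_step F (2 * pi / \<bar>t\<bar>)"
proof (rule disjCI)
  assume "\<not> lattice_step F (2 * pi / \<bar>t\<bar>)"
  show "cmod (char centered_law t) < 1"
  proof (rule ccontr)
    assume "\<not> cmod (char centered_law t) < 1"
    then have "cmod (char centered_law t) = 1" using C.cmod_char_le_1[of t] by simp
    then obtain x0 where "AE x in centered_law. (x - x0) / (2 * pi / \<bar>t\<bar>) \<in> \<int>"
      using C.char_eq_1_imp_lattice[OF t] by blast
    then have "AE x in G. (x - b - x0) / (2 * pi / \<bar>t\<bar>) \<in> \<int>"
      unfolding centered_law_def by (rule AE_distrD[rotated]) measurable
    then have "AE x in F. (x - (b + x0)) / (2 * pi / \<bar>t\<bar>) \<in> \<int>"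
      unfolding AE_G_iff by (simp only: diff_diff_eq)
    then have "lattice_step F (2 * pi / \<bar>t\<bar>)"
      using t by (auto simp: lattice_step_def)
    with \<open>\<not> lattice_step F (2 * pi / \<bar>t\<bar>)\<close> show False by simp
  qed
qed

lemma law_lattice:
  assumes h: "AE x in F. (x - b) / h \<in> \<int>" and I: "finite I"
  shows "AE x in law I. x / h \<in> \<int>"
proof -
  have [measurable]: "(\<int> :: real set) \<in> sets borel" by (intro borel_closed closed_Ints)
  have "AE x in P I. \<forall>i\<in>I. (x i - b) / h \<in> \<int>"
  proof (rule AE_finite_allI[OF I])
    fix i assume "i \<in> I"
    then show "AE x in P I. (x i - b) / h \<in> \<int>"
      using h by (intro AE_PiM_component prob_space_axioms) (auto simp: AE_G_iff)
  qed
  then have "AE x in P I. T I x / h \<in> \<int>"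
    by eventually_elim (auto simp: T_def sum_divide_distrib intro!: Ints_sum)
  then show ?thesis
    unfolding law_def by (subst AE_distr_iff) auto
qed

lemma tail_prob_eq:
  "tail_prob F n (b * real n) = exp (real n * cgf F \<theta> - \<theta> * (b * real n))
     * (\<integral>x. indicator {0..} x * exp (- \<theta> * x) \<partial>law {..<n})"
proof -
  have "tail_prob F n (b * real n) = exp (real n * cgf F \<theta> - \<theta> * (b * real n))
     * (\<integral>x. exp (- \<theta> * T {..<n} x) * indicator {x. b * real n \<le> (\<Sum>i<n. x i)} x \<partial>P {..<n})"
    unfolding tail_prob_def by (rule measure_PiM_untilt[OF prob_F F_eq_density_G]) measurable
  also have "(\<integral>x. exp (- \<theta> * T {..<n} x) * indicator {x. b * real n \<le> (\<Sum>i<n. x i)} x \<partial>P {..<n})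
      = (\<integral>x. indicator {0..} (T {..<n} x) * exp (- \<theta> * T {..<n} x) \<partial>P {..<n})"
    by (intro Bochner_Integration.integral_cong refl) (auto simp: T_def sum_subtractf indicator_def mult.commute)
  also have "\<dots> = (\<integral>x. indicator {0..} x * exp (- \<theta> * x) \<partial>law {..<n})"
    by (rule integral_law[symmetric]) measurable
  finally show ?thesis .
qed

text \<open>After tilting and freezing a coordinate above u, the other \<open>n - 1\<close>
  coordinates still satisfy the uniform tail bound. \<open>n > 1\<close> ensures that some remain;
  the factor n is the union over coordinates.\<close>

lemma large_coordinate_bound:
  assumes \<theta>: "\<theta> > 0"
  shows "\<exists>C\<ge>0. \<forall>n>1. \<forall>u. (\<Sum>i<n. measure (PiM {..<n} (\<lambda>_. F))
      {x \<in> space (PiM {..<n} (\<lambda>_. F)). b * real n \<le> (\<Sum>i<n. x i) \<and> x i > u})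
    \<le> exp (real n * cgf F \<theta> - \<theta> * (b * real n)) * (real n * (C / sqrt (real (n - 1)) * measure G {u<..}))"
proof -
  from C.uniform_exp_tail[OF \<theta>] obtain C where C: "C \<ge> 0" and tail: "\<forall>N n y. n > 0 \<longrightarrow> real_distribution N \<longrightarrow>
      (\<forall>t. char N t = char centered_law t ^ n) \<longrightarrow> (\<integral>x. indicator {y..} x * exp (- \<theta> * (x - y)) \<partial>N) \<le> C / sqrt (real n)"
    by (elim exE conjE)
  have "measure (PiM {..<n} (\<lambda>_. F)) {x \<in> space (PiM {..<n} (\<lambda>_. F)). b * real n \<le> (\<Sum>i<n. x i) \<and> x i > u}
     \<le> exp (real n * cgf F \<theta> - \<theta> * (b * real n)) * (C / sqrt (real (n - 1)) * measure G {u<..})"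
    if n: "n > 1" and i: "i < n" for n i u
  proof -
    let ?I = "{..<n} - {i}"
    have ins: "insert i ?I = {..<n}" using i by auto
    have card: "card ?I = n - 1" using i by simp
    have [measurable]: "Measurable.pred (P {..<n}) (\<lambda>x. x i > u)"
    proof -
      have "(\<lambda>x. x i) \<in> measurable (P {..<n}) G" using i by (intro measurable_component_singleton) auto
      moreover have "Measurable.pred G (\<lambda>y. y > u)" by measurable
      ultimately show ?thesis by (rule measurable_compose)
    qed
    have "measure (PiM {..<n} (\<lambda>_. F)) {x \<in> space (PiM {..<n} (\<lambda>_. F)). b * real n \<le> (\<Sum>i<n. x i) \<and> x i > u}
      = exp (real n * cgf F \<theta> - \<theta> * (b * real n))
        * (\<integral>x. exp (- \<theta> * T {..<n} x) * indicator {x. b * real n \<le> (\<Sum>i<n. x i) \<and> x i > u} x \<partial>P {..<n})"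
      by (rule measure_PiM_untilt[OF prob_F F_eq_density_G]) measurable
    also have "(\<integral>x. exp (- \<theta> * T {..<n} x) * indicator {x. b * real n \<le> (\<Sum>i<n. x i) \<and> x i > u} x \<partial>P {..<n})
        = (\<integral>x. indicator {0..} (T {..<n} x) * exp (- \<theta> * T {..<n} x) * indicator {u<..} (x i) \<partial>P {..<n})"
      by (intro Bochner_Integration.integral_cong refl) (auto simp: T_def sum_subtractf indicator_def mult.commute)
    also have "\<dots> \<le> C / sqrt (real (n - 1)) * measure G {u<..}"
    proof (rule exp_tail_with_large_coordinate[of \<theta> ?I i "C / sqrt (real (n - 1))" u, unfolded ins])
      show "(\<integral>x. indicator {y..} x * exp (- \<theta> * (x - y)) \<partial>law ?I) \<le> C / sqrt (real (n - 1))" for y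
      proof (rule tail[rule_format])
        show "char (law ?I) t = char centered_law t ^ (n - 1)" for t
          using char_law[of ?I t] unfolding card by simp
      qed (use n real_distribution_law in auto)
    qed (use \<theta> C in auto)
    finally show ?thesis by simp
  qed
  then have "(\<Sum>i<n. measure (PiM {..<n} (\<lambda>_. F)) {x \<in> space (PiM {..<n} (\<lambda>_. F)). b * real n \<le> (\<Sum>i<n. x i) \<and> x i > u})
     \<le> (\<Sum>i<n. exp (real n * cgf F \<theta> - \<theta> * (b * real n)) * (C / sqrt (real (n - 1)) * measure G {u<..}))"
    if "n > 1" for n u
    using that by (intro sum_mono) auto
  then show ?thesis using C by (intro exI[of _ C]) (simp add: mult_ac)
qed

end

section \<open>The tail asymptotics\<close>

text \<open>If \<open>\<theta> \<le> 0\<close>, then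
  \<open>(x - b) exp (\<theta> (x - b)) \<le> x - b\<close> for every x. The left side has integral
  0 at the saddle point, so the mean would be at least b.\<close>

lemma saddle_pos:
  assumes F: "prob_space F" "sets F = sets borel" and d0: "0 \<in> interior (cgf_dom F)"
    and d: "\<theta> \<in> interior (cgf_dom F)" and saddle: "deriv (cgf F) \<theta> = b" and b: "b > (\<integral>x. x \<partial>F)"
  shows "\<theta> > 0"
proof (rule ccontr)
  assume neg: "\<not> \<theta> > 0"
  interpret prob_space F by (rule F)
  obtain r where r: "r > 0" "\<theta> - r \<in> cgf_dom F" "\<theta> + r \<in> cgf_dom F"
    using interior_cgf_dom_interval[OF d] by blast
  obtain r0 where r0: "r0 > 0" "0 - r0 \<in> cgf_dom F" "0 + r0 \<in> cgf_dom F"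
    using interior_cgf_dom_interval[OF d0] by blast
  have int: "integrable F (\<lambda>x. x)"
    using integrable_power_exp[OF F(2) r0, of 0 1] r0(1) by simp
  have int1: "integrable F (\<lambda>x. x ^ k * exp (\<theta> * x))" for k
    using r(1) by (intro integrable_power_exp[OF F(2) r]) auto
  have pos: "(\<integral>x. exp (\<theta> * x) \<partial>F) > 0"
    using r(1) by (intro exp_integral_pos[OF F(2) r F(1)]) auto
  have "(\<integral>x. x * exp (\<theta> * x) \<partial>F) = b * (\<integral>x. exp (\<theta> * x) \<partial>F)"
    using saddle pos unfolding deriv_cgf[OF F(2) r F(1)] by (simp add: field_simps)
  \<comment> \<open>The factor \<open>exp (- (\<theta> * b))\<close> centers the exponent at b,
    which the pointwise comparison requires.\<close>
  then have "0 = exp (- (\<theta> * b)) * ((\<integral>x. x * exp (\<theta> * x) \<partial>F) - b * (\<integral>x. exp (\<theta> * x) \<partial>F))" by simp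
  also have "\<dots> = (\<integral>x. exp (- (\<theta> * b)) * (x * exp (\<theta> * x) - b * exp (\<theta> * x)) \<partial>F)"
    using int1[of 0] int1[of 1] by simp
  also have "\<dots> \<le> (\<integral>x. x - b \<partial>F)"
  proof (rule integral_mono)
    show "integrable F (\<lambda>x. exp (- (\<theta> * b)) * (x * exp (\<theta> * x) - b * exp (\<theta> * x)))"
      using int1[of 0] int1[of 1] by simp
    show "integrable F (\<lambda>x. x - b)" using int by simp
    fix x
    have "exp (- (\<theta> * b)) * (x * exp (\<theta> * x) - b * exp (\<theta> * x)) = (x - b) * exp (\<theta> * (x - b))"
      by (simp add: algebra_simps exp_diff exp_minus field_simps)
    also have "\<dots> \<le> (x - b) * 1"
    proof (cases "x \<ge> b")
      case True
      then have "exp (\<theta> * (x - b)) \<le> 1" using neg by (simp add: mult_nonpos_nonneg)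
      then show ?thesis using True by (intro mult_left_mono) auto
    next
      case False
      then have "exp (\<theta> * (x - b)) \<ge> 1" using neg by (simp add: mult_nonpos_nonpos)
      then show ?thesis using False by (intro mult_left_mono_neg) auto
    qed
    finally show "exp (- (\<theta> * b)) * (x * exp (\<theta> * x) - b * exp (\<theta> * x)) \<le> x - b" by simp
  qed
  also have "\<dots> = (\<integral>x. x \<partial>F) - b" using int by (simp add: prob_space)
  finally show False using b by simp
qed

context cramer_tilt
begin

definition c :: "nat \<Rightarrow> real" where
  "c n = \<theta> * sqrt (2 * pi * real n * deriv (deriv (cgf F)) \<theta>) * exp (\<theta> * real n * b - real n * cgf F \<theta>)"

text \<open>The exponential in c is the inverse of the prefactor from the change of measure; only
  the scale \<open>sqrt n\<close> of the local limits is left.\<close>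

lemma c_eq: "c n * exp (real n * cgf F \<theta> - \<theta> * (b * real n)) = \<theta> * \<sigma> * sqrt (2 * pi) * sqrt (real n)"
proof -
  have "exp (\<theta> * real n * b - real n * cgf F \<theta>) * exp (real n * cgf F \<theta> - \<theta> * (b * real n)) = 1"
    by (simp add: exp_add[symmetric] mult_ac)
  moreover have "sqrt (2 * pi * real n * deriv (deriv (cgf F)) \<theta>) = \<sigma> * sqrt (2 * pi) * sqrt (real n)"
    by (simp add: \<sigma>_def real_sqrt_mult)
  ultimately show ?thesis unfolding c_def by (simp add: mult.assoc)
qed

lemma tail_prob_limit:
  assumes \<theta>: "\<theta> > 0"
  shows "\<not> lattice_dist F \<Longrightarrow> (\<lambda>n. c n * tail_prob F n (b * real n)) \<longlonglongrightarrow> 1"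
    and "lattice_span F h \<Longrightarrow> measure F {b} > 0 \<Longrightarrow>
      (\<lambda>n. c n * tail_prob F n (b * real n)) \<longlonglongrightarrow> \<theta> * h / (1 - exp (- \<theta> * h))"
proof -
  let ?E = "\<lambda>n. \<integral>x. indicator {0..} x * exp (- \<theta> * x) \<partial>law {..<n}"
  have eq: "c n * tail_prob F n (b * real n) = \<theta> * \<sigma> * sqrt (2 * pi) * (sqrt (real n) * ?E n)" for n
  proof -
    have "p * (q * x) = r * (s * x)" if "p * q = r * s" for p q r s x :: real
      using that by (simp flip: mult.assoc)
    then show ?thesis unfolding tail_prob_eq using c_eq by blast
  qed
  have k1: "\<theta> * \<sigma> * sqrt (2 * pi) * (1 / (\<theta> * \<sigma> * sqrt (2 * pi))) = 1"
    using \<theta> C.\<sigma>_pos by simp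
  have k2: "\<theta> * \<sigma> * sqrt (2 * pi) * (y / z / (\<sigma> * sqrt (2 * pi))) = \<theta> * y / z" for y z
    using C.\<sigma>_pos by simp
  have ch: "char (law {..<n}) t = char centered_law t ^ n" for n t
    using char_law[of "{..<n}" t] by simp
  {
    assume nl: "\<not> lattice_dist F"
    have "(\<lambda>n. sqrt (real n) * ?E n) \<longlonglongrightarrow> 1 / (\<theta> * \<sigma> * sqrt (2 * pi))"
      using nl char_lt_1_or_lattice
      by (intro C.nonlattice_exp_integral_limit[OF \<theta> real_distribution_law ch]) (auto simp: lattice_dist_def)
    from tendsto_mult[OF tendsto_const[of "\<theta> * \<sigma> * sqrt (2 * pi)"] this]
    show "(\<lambda>n. c n * tail_prob F n (b * real n)) \<longlonglongrightarrow> 1"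
      unfolding eq k1 .
  }
  {
    assume h: "lattice_span F h" and atom: "measure F {b} > 0"
    have h0: "h > 0" using h by (simp add: lattice_span_def lattice_step_def)
    obtain x0 where x0: "AE x in F. (x - x0) / h \<in> \<int>"
      using h by (auto simp: lattice_span_def lattice_step_def)
    \<comment> \<open>Off the lattice, b could not be an atom. With b on it, the centered variables
      take values in the multiples of h.\<close>
    have b0: "(b - x0) / h \<in> \<int>"
    proof (rule ccontr)
      assume "(b - x0) / h \<notin> \<int>"
      then have "AE x in F. x \<noteq> b" using x0 by (auto elim!: eventually_mono)
      then have "measure F {b} = 0" by (subst (asm) AE_iff_measurable[of "{b}"]) (auto simp: sets_F F.emeasure_eq_measure sets_eq_imp_space_eq[OF sets_F])
      with atom show False by simp
    qed
    have lat: "AE x in F. (x - b) / h \<in> \<int>"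
      using x0
    proof eventually_elim
      fix x assume "(x - x0) / h \<in> \<int>"
      from Ints_diff[OF this b0] show "(x - b) / h \<in> \<int>" by (simp add: diff_divide_distrib)
    qed
    have "(\<lambda>n. sqrt (real n) * ?E n) \<longlonglongrightarrow> h / (1 - exp (- \<theta> * h)) / (\<sigma> * sqrt (2 * pi))"
    proof (rule C.lattice_exp_integral_limit[OF \<theta> h0 real_distribution_law ch law_lattice[OF lat]])
      fix t :: real assume t: "0 < \<bar>t\<bar>" "\<bar>t\<bar> < 2 * pi / h"
      show "cmod (char centered_law t) < 1"
      proof (rule ccontr)
        assume "\<not> cmod (char centered_law t) < 1"
        \<comment> \<open>Otherwise \<open>2 * pi / |t|\<close> would be a lattice step, and h is
          the largest one; yet t was chosen to make it exceed h.\<close>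
        then have "2 * pi / \<bar>t\<bar> \<le> h"
          using char_lt_1_or_lattice[of t] t h by (auto simp: lattice_span_def)
        then show False using t h0 by (simp add: field_simps)
      qed
    qed auto
    from tendsto_mult[OF tendsto_const[of "\<theta> * \<sigma> * sqrt (2 * pi)"] this]
    show "(\<lambda>n. c n * tail_prob F n (b * real n)) \<longlonglongrightarrow> \<theta> * h / (1 - exp (- \<theta> * h))"
      unfolding eq k2 .
  }
qed

text \<open>Since \<open>\<theta> + \<theta>'\<close> lies in the domain of F, the tilted law has an
  exponential moment of order \<theta>', and Markov's inequality gives
  \<open>measure G {u<..} = O(exp (- \<theta>' u))\<close>. Under F the exponent improves to
  \<open>\<theta> + \<theta>'\<close>, which also controls the normalisation of the truncated
  law.\<close>

lemma truncated_tail_prob_limit: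
  assumes \<theta>: "\<theta> > 0" and \<theta>': "\<theta>' > 0" "\<theta> + \<theta>' \<in> cgf_dom F"
    and u: "(\<lambda>n. real n * exp (- \<theta>' * u n)) \<longlonglongrightarrow> 0"
    and lim: "(\<lambda>n. c n * tail_prob F n (b * real n)) \<longlonglongrightarrow> L" and L: "L > 0"
  shows "(\<lambda>n. c n * tail_prob (trunc_dist F (u n)) n (b * real n)) \<longlonglongrightarrow> L"
    and "(\<lambda>n. tail_prob (trunc_dist F (u n)) n (b * real n) - tail_prob F n (b * real n))
      \<in> o(\<lambda>n. tail_prob F n (b * real n))"
proof -
  obtain C where C: "C \<ge> 0" and large: "\<forall>n>1. \<forall>u. (\<Sum>i<n. measure (PiM {..<n} (\<lambda>_. F))
      {x \<in> space (PiM {..<n} (\<lambda>_. F)). b * real n \<le> (\<Sum>i<n. x i) \<and> x i > u})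
    \<le> exp (real n * cgf F \<theta> - \<theta> * (b * real n)) * (real n * (C / sqrt (real (n - 1)) * measure G {u<..}))"
    using large_coordinate_bound[OF \<theta>] by (elim exE conjE)
  have intF: "integrable F (\<lambda>x. exp ((\<theta> + \<theta>') * x))" using \<theta>' by (simp add: cgf_dom_def)
  have intG: "integrable G (\<lambda>x. exp (\<theta>' * x))"
    using intF by (intro integrable_G) (auto simp: exp_add[symmetric] algebra_simps)
  define D where "D = (\<integral>x. exp (\<theta>' * x) \<partial>G)"
  define D' where "D' = (\<integral>x. exp ((\<theta> + \<theta>') * x) \<partial>F)"
  have D': "D' \<ge> 0" unfolding D'_def by (intro integral_nonneg_AE) auto
  have GD: "measure G {v<..} \<le> exp (- \<theta>' * v) * D" for v
    unfolding D_def using \<theta>' by (intro exp_markov sets_G intG finite_measure_axioms) auto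
  have FD: "measure F {v<..} \<le> exp (- (\<theta> + \<theta>') * v) * D'" for v
    unfolding D'_def using \<theta> \<theta>' by (intro exp_markov sets_F intF F.finite_measure_axioms) auto
  have compl: "1 - measure F {..v} = measure F {v<..}" for v
  proof -
    have "space F - {..v} = {v<..}" using sets_eq_imp_space_eq[OF sets_F] by auto
    with F.prob_compl[of "{..v}"] show ?thesis by (simp add: sets_F)
  qed
  \<comment> \<open>The hypothesis on u forces \<open>u n > 0\<close> eventually, since otherwise
    \<open>n exp (- \<theta>' u)\<close> would be at least 1.\<close>
  have ev_u: "\<forall>\<^sub>F n in sequentially. exp (- \<theta> * u n) \<le> 1"
  proof -
    have "\<forall>\<^sub>F n in sequentially. real n * exp (- \<theta>' * u n) < 1"
      using u by (rule order_tendstoD) simp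
    with eventually_gt_at_top[of 0] show ?thesis
    proof eventually_elim
      fix n :: nat assume n: "0 < n" "real n * exp (- \<theta>' * u n) < 1"
      have "1 * exp (- \<theta>' * u n) \<le> real n * exp (- \<theta>' * u n)" using n(1) by (intro mult_right_mono) auto
      with n(2) have "exp (- \<theta>' * u n) < 1" by linarith
      then have "u n > 0" using \<theta>'(1) by (simp add: zero_less_mult_iff)
      then show "exp (- \<theta> * u n) \<le> 1" using \<theta> by simp
    qed
  qed
  have nF: "(\<lambda>n. real n * (1 - measure F {..u n})) \<longlonglongrightarrow> 0"
  proof (rule Lim_null_comparison)
    show "(\<lambda>n. real n * exp (- \<theta>' * u n) * D') \<longlonglongrightarrow> 0" using u by (rule tendsto_mult_left_zero)
    show "\<forall>\<^sub>F n in sequentially. norm (real n * (1 - measure F {..u n})) \<le> real n * exp (- \<theta>' * u n) * D'"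
      using ev_u
    proof eventually_elim
      fix n assume "exp (- \<theta> * u n) \<le> 1"
      then have "exp (- \<theta> * u n) * (exp (- \<theta>' * u n) * D') \<le> 1 * (exp (- \<theta>' * u n) * D')"
        using D' by (intro mult_right_mono) auto
      moreover have "exp (- (\<theta> + \<theta>') * u n) * D' = exp (- \<theta> * u n) * (exp (- \<theta>' * u n) * D')"
        by (simp add: exp_add[symmetric] algebra_simps)
      ultimately have "measure F {u n<..} \<le> exp (- \<theta>' * u n) * D'" using FD[of "u n"] by linarith
      then have "real n * measure F {u n<..} \<le> real n * (exp (- \<theta>' * u n) * D')" by (intro mult_left_mono) auto
      then show "norm (real n * (1 - measure F {..u n})) \<le> real n * exp (- \<theta>' * u n) * D'"
        unfolding compl by simp
    qed
  qed
  have Q: "(\<lambda>n. measure F {..u n} ^ n) \<longlonglongrightarrow> 1"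
    using nF by (intro power_tendsto_1) auto
  define R where "R n = exp (real n * cgf F \<theta> - \<theta> * (b * real n)) * (real n * (C / sqrt (real (n - 1)) * (exp (- \<theta>' * u n) * D)))" for n
  have bound: "\<forall>\<^sub>F n in sequentially. \<bar>tail_prob F n (b * real n) - tail_prob (trunc_dist F (u n)) n (b * real n) * measure F {..u n} ^ n\<bar> \<le> R n"
  proof -
    have "\<forall>\<^sub>F n in sequentially. real n * (1 - measure F {..u n}) < 1"
      using nF by (rule order_tendstoD) simp
    with eventually_gt_at_top[of 1] show ?thesis
    proof eventually_elim
      fix n :: nat assume n: "1 < n" "real n * (1 - measure F {..u n}) < 1"
      \<comment> \<open>The truncated law is a probability only if some mass lies below the level; a
        defect that stays below 1 even after multiplication by n ensures it.\<close>
      have "1 * (1 - measure F {..u n}) \<le> real n * (1 - measure F {..u n})"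
        using n(1) by (intro mult_right_mono) auto
      from le_less_trans[OF this n(2)] have pos: "measure F {..u n} > 0" by simp
      have "real n * (C / sqrt (real (n - 1)) * measure G {u n<..}) \<le> real n * (C / sqrt (real (n - 1)) * (exp (- \<theta>' * u n) * D))"
        using C GD by (intro mult_left_mono) auto
      then have "exp (real n * cgf F \<theta> - \<theta> * (b * real n)) * (real n * (C / sqrt (real (n - 1)) * measure G {u n<..})) \<le> R n"
        unfolding R_def by (rule mult_left_mono) simp
      with tail_prob_truncation_defect[OF prob_F sets_F pos, of n "b * real n"] large[rule_format, OF n(1), of "u n"]
      show "\<bar>tail_prob F n (b * real n) - tail_prob (trunc_dist F (u n)) n (b * real n) * measure F {..u n} ^ n\<bar> \<le> R n"
        by linarith
    qed
  qed
  have "(\<lambda>n. c n * R n) \<longlonglongrightarrow> 0"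
  proof -
    \<comment> \<open>The \<open>sqrt n\<close> of c meets the \<open>1 / sqrt (n - 1)\<close> of
      the concentration bound; their ratio tends to 1, and exactly
      \<open>n exp (- \<theta>' u)\<close> remains.\<close>
    have "(\<lambda>n. \<theta> * \<sigma> * sqrt (2 * pi) * C * D * (sqrt (real n) / sqrt (real (n - 1))) * (real n * exp (- \<theta>' * u n))) \<longlonglongrightarrow> \<theta> * \<sigma> * sqrt (2 * pi) * C * D * 1 * 0"
    proof (intro tendsto_mult[OF tendsto_mult[OF tendsto_const]] u)
      have "(\<lambda>n. sqrt (real (Suc n)) / sqrt (real n)) \<longlonglongrightarrow> 1" by real_asymp
      then show "(\<lambda>n. sqrt (real n) / sqrt (real (n - 1))) \<longlonglongrightarrow> 1"
        by (subst filterlim_sequentially_Suc[symmetric]) simp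
    qed
    moreover have "c n * R n = \<theta> * \<sigma> * sqrt (2 * pi) * C * D * (sqrt (real n) / sqrt (real (n - 1))) * (real n * exp (- \<theta>' * u n))" for n
    proof -
      have "c n * R n = (c n * exp (real n * cgf F \<theta> - \<theta> * (b * real n))) * (real n * (C / sqrt (real (n - 1)) * (exp (- \<theta>' * u n) * D)))"
        unfolding R_def by (rule mult.assoc[symmetric])
      then show ?thesis unfolding c_eq by simp
    qed
    ultimately show ?thesis by simp
  qed
  moreover have "c n \<ge> 0" for n unfolding c_def using \<theta> deriv2_pos by simp
  ultimately show "(\<lambda>n. c n * tail_prob (trunc_dist F (u n)) n (b * real n)) \<longlonglongrightarrow> L"
    "(\<lambda>n. tail_prob (trunc_dist F (u n)) n (b * real n) - tail_prob F n (b * real n)) \<in> o(\<lambda>n. tail_prob F n (b * real n))"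
    using truncation_negligible[OF lim L bound _ _ Q] by auto
qed

end

theorem theorem6:
  fixes F :: "real measure" and b \<theta>s :: real and u :: "nat \<Rightarrow> real"
  assumes F: "prob_space F" "sets F = sets borel"
    and b: "b > (\<integral>x. x \<partial>F)"
    and cases: "(\<exists>h. lattice_span F h \<and> 0 < measure F {b} \<and> measure F {b} < 1) \<or> \<not> lattice_dist F"
    and zero: "0 \<in> interior (cgf_dom F)"
    and ts: "\<theta>s \<in> interior (cgf_dom F)" "deriv (cgf F) \<theta>s = b"
    and ts_unique: "\<forall>\<theta>\<in>interior (cgf_dom F). deriv (cgf F) \<theta> = b \<longrightarrow> \<theta> = \<theta>s"
    and u: "\<exists>\<theta>'>0. \<theta>s + \<theta>' \<in> interior (cgf_dom F) \<and>
               (\<lambda>n. real n * exp (- \<theta>' * u n)) \<longlonglongrightarrow> 0"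
  defines "c \<equiv> (\<lambda>n::nat. \<theta>s * sqrt (2 * pi * real n * deriv (deriv (cgf F)) \<theta>s)
                   * exp (\<theta>s * real n * b - real n * cgf F \<theta>s))"
  shows "(\<not> lattice_dist F \<longrightarrow>
            (\<lambda>n. c n * tail_prob F n (b * real n)) \<longlonglongrightarrow> 1 \<and>
            (\<lambda>n. c n * tail_prob (trunc_dist F (u n)) n (b * real n)) \<longlonglongrightarrow> 1)
       \<and> (\<forall>h. lattice_span F h \<longrightarrow>
            (\<lambda>n. c n * tail_prob F n (b * real n)) \<longlonglongrightarrow> \<theta>s * h / (1 - exp (- \<theta>s * h)) \<and>
            (\<lambda>n. c n * tail_prob (trunc_dist F (u n)) n (b * real n))
               \<longlonglongrightarrow> \<theta>s * h / (1 - exp (- \<theta>s * h)))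
       \<and> (\<lambda>n. tail_prob (trunc_dist F (u n)) n (b * real n) - tail_prob F n (b * real n))
            \<in> o(\<lambda>n. tail_prob F n (b * real n))"
proof -
  interpret F: prob_space F by (rule F)
  have sp: "space F = UNIV" using sets_eq_imp_space_eq[OF F(2)] by simp
  have \<theta>: "\<theta>s > 0" by (rule saddle_pos[OF F zero ts b])
  obtain d where d: "d > 0" "\<theta>s - d \<in> cgf_dom F" "\<theta>s + d \<in> cgf_dom F"
    using interior_cgf_dom_interval[OF ts(1)] by blast
  \<comment> \<open>A point mass at b is a lattice law with an atom of mass 1, which both
    alternatives of \<open>cases\<close> exclude.\<close>
  have nondeg: "\<not> (AE x in F. x = b)"
  proof
    assume ae: "AE x in F. x = b"
    then have "lattice_step F 1" by (auto simp: lattice_step_def intro!: exI[of _ b] elim!: eventually_mono)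
    moreover have "measure F {b} = 1"
      using ae by (subst F.prob_eq_1) (auto simp: F(2))
    ultimately show False using cases by (auto simp: lattice_dist_def)
  qed
  interpret X: cramer_tilt F \<theta>s d b
    using F d ts(2) nondeg by unfold_locales auto
  have c: "c = X.c" by (simp add: c_def X.c_def fun_eq_iff)
  obtain \<theta>' where \<theta>': "\<theta>' > 0" "\<theta>s + \<theta>' \<in> cgf_dom F" and u': "(\<lambda>n. real n * exp (- \<theta>' * u n)) \<longlonglongrightarrow> 0"
    using u interior_subset by blast
  note trunc = X.truncated_tail_prob_limit[OF \<theta> \<theta>' u']
  have nl: "(\<lambda>n. X.c n * tail_prob F n (b * real n)) \<longlonglongrightarrow> 1" if "\<not> lattice_dist F"
    using X.tail_prob_limit(1)[OF \<theta> that] .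
  have lat: "(\<lambda>n. X.c n * tail_prob F n (b * real n)) \<longlonglongrightarrow> \<theta>s * h / (1 - exp (- \<theta>s * h))"
    if h: "lattice_span F h" for h
  proof (rule X.tail_prob_limit(2)[OF \<theta> h])
    have "lattice_dist F" using h by (auto simp: lattice_dist_def lattice_span_def)
    \<comment> \<open>The atom condition does not mention the span, so it holds whichever h is
      given.\<close>
    then show "measure F {b} > 0" using cases by blast
  qed
  have pos: "\<theta>s * h / (1 - exp (- \<theta>s * h)) > 0" if "lattice_span F h" for h
    using that \<theta> by (simp add: lattice_span_def lattice_step_def)
  have small: "(\<lambda>n. tail_prob (trunc_dist F (u n)) n (b * real n) - tail_prob F n (b * real n))
      \<in> o(\<lambda>n. tail_prob F n (b * real n))"
    using cases trunc(2)[OF nl zero_less_one] trunc(2)[OF lat pos] by blast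
  show ?thesis
    unfolding c using nl lat trunc(1)[OF nl zero_less_one] trunc(1)[OF lat pos] small by blast
qed

end
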